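(* Let $d^{(l)}_i$ be the degree of left-vertex $i$ in $\mathrm{BGRG}_n(\mathbf w)$, $d^{(r)}_a$ the degree of group $a$ in $\mathrm{BGRG}_n(\mathbf w)$, and $D=(\mathbf d^{(l)},\mathbf d^{(r)})=\big((d^{(l)}_i)_{i\in[n]},(d_a^{(r)})_{a\in[m]}\big)$. Then $$\mathbf P(\mathrm{BGRG}_n(\mathbf w)=G\mid D=\mathbf d)=\mathbf P(\mathrm{BCM}_n(\mathbf d)=G\mid \mathrm{BCM}_n(\mathbf d)\text{ simple}).$$ Moreover, let $\mathcal E_n$ be a subset of multigraphs such that $\mathbf P(\mathrm{BCM}_n(D)\in\mathcal E_n\mid D)\to1$ in probability when $D$ satisfies the regularity conditions (i) and (ii) listed in the context. Assume that the degree sequence $D$ of $\mathrm{BGRG}_n(\mathbf w)$ satisfies these regularity conditions. Then also $\mathbf P(\mathrm{BGRG}_n(\mathbf w)\in\mathcal E_n)\to1$ as $n\to\infty$.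
   Context: Notation. $[n]=\{1,\dots,n\}$; $[n]_k$ is the set of $k$-element subsets of $[n]$; elements $a\in\bigcup_{k\ge 2}[n]_k$ are called groups and $|a|$ is the size of $a$. For each $n$, $\mathbf{w}=(w_i)_{i\in[n]}$ are deterministic nonnegative vertex weights, $\ell_n=\sum_{i\in[n]}w_i>0$. $(p_k)_{k\ge2}$ is a probability mass function with $\sum_{k\ge2}kp_k<\infty$ and $\sum_{k\ge2}k^2p_k<\infty$; $f(k)=k!\,p_k$. $\mathrm{BGRG}_n(\mathbf w)$. Independently over groups, group $a$ is ON with probability $\dfrac{f(|a|)\prod_{i\in a}w_i}{\ell_n^{|a|-1}+f(|a|)\prod_{i\in a}w_i}$. $\mathrm{BGRG}_n(\mathbf w)$ is the bipartite graph with left-vertices $[n]$ and right-vertices the ON groups, each ON group $a$ being joined to exactly the left-vertices $i\in a$; so the degree of an ON group is its size. The right-vertices are indexed by $[m]$, where $m$ is their number. $\mathrm{BCM}_n(\mathbf d)$. For a degree sequence $\mathbf d=((d_i^{(l)})_{i\in[n]},(d_a^{(r)})_{a\in[m]})$ with $\sum_id_i^{(l)}=\sum_ad_a^{(r)}$, attach $d_i^{(l)}$ half-edges to each left-vertex $i$ and $d_a^{(r)}$ half-edges to each right-vertex $a$, match left half-edges to right half-edges by a uniformly random bijection, and let each matched pair form an edge; the resulting bipartite multigraph is the bipartite configuration model. It is simple if it has no multiple edges. In the displayed identity, $G$ denotes a bipartite graph with the same left- and right-vertices, and $\mathbf d$ a possible value of $D$. Regularity conditions. Let $D_n^{(l)}$,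 $D_n^{(r)}$ be the degrees of a uniformly chosen left-vertex and a uniformly chosen right-vertex; $\,\cdot\mid G_n$ denotes conditioning on the realisation of the random graph. (i) There are random variables $D^{(l)},D^{(r)}$ with finite means such that, as $n\to\infty$, for all $j\ge0$, $k\ge2$, $\mathbf P(D_n^{(l)}=j\mid G_n)\to\mathbf P(D^{(l)}=j)$ and $\mathbf P(D_n^{(r)}=k\mid G_n)\to\mathbf P(D^{(r)}=k)$ in probability, and $\mathbf E[D_n^{(l)}\mid G_n]\to\mathbf E[D^{(l)}]$, $\mathbf E[D_n^{(r)}\mid G_n]\to\mathbf E[D^{(r)}]$ in probability. (ii) $\mathbf E[(D^{(l)})^2],\mathbf E[(D^{(r)})^2]<\infty$, and $\mathbf E[(D_n^{(l)})^2\mid G_n]\to\mathbf E[(D^{(l)})^2]$, $\mathbf E[(D_n^{(r)})^2\mid G_n]\to\mathbf E[(D^{(r)})^2]$ in probability.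
   Formalization: The identity conditions the BCM on being simple with pairwise distinct right-vertex neighbourhoods, since with simplicity alone it is false; the second part additionally assumes E[D^(l)] > 0, without which it fails; the ON groups are labelled in uniformly random order. *)

theory Defs
  imports "HOL-Probability.Probability" "HOL-Combinatorics.Multiset_Permutations"
begin

text \<open>Bipartite multigraphs with left-vertices \<open>{1..nleft G}\<close> and right-vertices
  \<open>{1..nright G}\<close>. An edge \<open>(i, a)\<close> joins the left-vertex \<open>i\<close> to the right-vertex \<open>a\<close>
  and may occur several times.\<close>

datatype bmgraph = BMGraph (nleft: nat) (nright: nat) (edges: "(nat \<times> nat) multiset")

definition deg_left :: "bmgraph \<Rightarrow> nat \<Rightarrow> nat" where
  "deg_left G i = size {#e \<in># edges G. fst e = i#}"

definition deg_right :: "bmgraph \<Rightarrow> nat \<Rightarrow> nat" where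
  "deg_right G a = size {#e \<in># edges G. snd e = a#}"

text \<open>In degree sequences the degree of vertex \<open>i\<close> is the list entry with index \<open>i - 1\<close>.\<close>

type_synonym degree_seq = "nat list \<times> nat list"

definition degree_sequence :: "bmgraph \<Rightarrow> degree_seq" where
  "degree_sequence G =
     (map (deg_left G) [1..<Suc (nleft G)], map (deg_right G) [1..<Suc (nright G)])"

definition simple_bmgraph :: "bmgraph \<Rightarrow> bool" where
  "simple_bmgraph G \<longleftrightarrow> (\<forall>e. count (edges G) e \<le> 1)"

definition nbrs_right :: "bmgraph \<Rightarrow> nat \<Rightarrow> nat set" where
  "nbrs_right G a = {i. (i, a) \<in># edges G}"

text \<open>Different right-vertices are different groups, that is, have different sets of
  neighbours. A simple bipartite graph may violate this, whereas the groups that are ON in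
  the bipartite generalized random graph are always pairwise different. Conditioning the
  configuration model on simplicity alone therefore does not give the conditional law of the
  generalized random graph: for four left-vertices and four right-vertices of degree 2, only
  72 of the 90 simple bipartite graphs have distinct groups.\<close>

definition distinct_groups :: "bmgraph \<Rightarrow> bool" where
  "distinct_groups G \<longleftrightarrow> inj_on (nbrs_right G) {1..nright G}"


definition groups :: "nat \<Rightarrow> nat set set" where
  "groups n = {a. a \<subseteq> {1..n} \<and> 2 \<le> card a}"

definition total_weight :: "nat \<Rightarrow> (nat \<Rightarrow> real) \<Rightarrow> real" where
  "total_weight n w = (\<Sum>i\<in>{1..n}. w i)"

definition size_factor :: "nat pmf \<Rightarrow> nat \<Rightarrow> real" where
  "size_factor p k = fact k * pmf p k"

definition on_prob :: "nat pmf \<Rightarrow> nat \<Rightarrow> (nat \<Rightarrow> real) \<Rightarrow> nat set \<Rightarrow> real" where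
  "on_prob p n w a =
     size_factor p (card a) * (\<Prod>i\<in>a. w i)
       / (total_weight n w ^ (card a - 1) + size_factor p (card a) * (\<Prod>i\<in>a. w i))"

definition on_groups :: "nat pmf \<Rightarrow> nat \<Rightarrow> (nat \<Rightarrow> real) \<Rightarrow> nat set set pmf" where
  "on_groups p n w =
     map_pmf (\<lambda>s. {a \<in> groups n. s a})
       (Pi_pmf (groups n) False (\<lambda>a. bernoulli_pmf (on_prob p n w a)))"

definition graph_of_groups :: "nat \<Rightarrow> nat set list \<Rightarrow> bmgraph" where
  "graph_of_groups n as =
     BMGraph n (length as) (mset_set {(i, a). a \<in> {1..length as} \<and> i \<in> as ! (a - 1)})"

text \<open>The ON groups receive the labels \<open>1, \<dots>, m\<close> in uniformly random order. No fixed
  enumeration of the groups would do: the right-vertices of a configuration model with given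
  degrees are exchangeable among those of equal degree.\<close>

definition BGRG :: "nat pmf \<Rightarrow> nat \<Rightarrow> (nat \<Rightarrow> real) \<Rightarrow> bmgraph pmf" where
  "BGRG p n w =
     bind_pmf (on_groups p n w) (\<lambda>A.
       map_pmf (graph_of_groups n) (pmf_of_set (permutations_of_set A)))"

definition degree_law :: "nat pmf \<Rightarrow> nat \<Rightarrow> (nat \<Rightarrow> real) \<Rightarrow> degree_seq pmf" where
  "degree_law p n w = map_pmf degree_sequence (BGRG p n w)"


text \<open>The half-edge \<open>(i, s)\<close> is the \<open>s\<close>-th one attached to vertex \<open>i\<close>.\<close>

definition half_edges :: "nat list \<Rightarrow> (nat \<times> nat) set" where
  "half_edges ds = (SIGMA i:{1..length ds}. {1..ds ! (i - 1)})"

definition matchings :: "degree_seq \<Rightarrow> (nat \<times> nat \<Rightarrow> nat \<times> nat) set" where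
  "matchings d =
     {\<sigma> \<in> half_edges (fst d) \<rightarrow>\<^sub>E half_edges (snd d).
        bij_betw \<sigma> (half_edges (fst d)) (half_edges (snd d))}"

definition graph_of_matching :: "degree_seq \<Rightarrow> (nat \<times> nat \<Rightarrow> nat \<times> nat) \<Rightarrow> bmgraph" where
  "graph_of_matching d \<sigma> =
     BMGraph (length (fst d)) (length (snd d))
       (image_mset (\<lambda>h. (fst h, fst (\<sigma> h))) (mset_set (half_edges (fst d))))"

text \<open>Meaningful only if both components of \<open>d\<close> have the same sum; otherwise there
  are no matchings.\<close>

definition BCM :: "degree_seq \<Rightarrow> bmgraph pmf" where
  "BCM d = map_pmf (graph_of_matching d) (pmf_of_set (matchings d))"


text \<open>Convergence in probability to a constant, for random variables that may live on
  different probability spaces.\<close>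

definition tendsto_in_prob ::
    "(nat \<Rightarrow> 'a pmf) \<Rightarrow> (nat \<Rightarrow> 'a \<Rightarrow> real) \<Rightarrow> real \<Rightarrow> bool" where
  "tendsto_in_prob M X c \<longleftrightarrow>
     (\<forall>\<epsilon>>0. (\<lambda>n. measure_pmf.prob (M n) {x. \<bar>X n x - c\<bar> > \<epsilon>}) \<longlonglongrightarrow> 0)"

text \<open>The probability that a uniformly chosen entry of \<open>ds\<close> equals \<open>k\<close>, and the
  \<open>r\<close>-th moment of that entry. Both are 0 for the empty list, which occurs for the
  right-vertices if no group is ON.\<close>

definition unif_prob :: "nat list \<Rightarrow> nat \<Rightarrow> real" where
  "unif_prob ds k = real (card {i. i < length ds \<and> ds ! i = k}) / real (length ds)"

definition unif_moment :: "nat \<Rightarrow> nat list \<Rightarrow> real" where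
  "unif_moment r ds = (\<Sum>i<length ds. real (ds ! i) ^ r) / real (length ds)"

text \<open>Here \<open>M n\<close> is the law of the random degree sequence, and \<open>Dl\<close> and \<open>Dr\<close> are the
  laws of the limiting left- and right-degree.\<close>

definition regular_i :: "(nat \<Rightarrow> degree_seq pmf) \<Rightarrow> nat pmf \<Rightarrow> nat pmf \<Rightarrow> bool" where
  "regular_i M Dl Dr \<longleftrightarrow>
     integrable Dl real \<and> integrable Dr real \<and>
     (\<forall>j. tendsto_in_prob M (\<lambda>n d. unif_prob (fst d) j) (pmf Dl j)) \<and>
     (\<forall>k\<ge>2. tendsto_in_prob M (\<lambda>n d. unif_prob (snd d) k) (pmf Dr k)) \<and>
     tendsto_in_prob M (\<lambda>n d. unif_moment 1 (fst d)) (measure_pmf.expectation Dl real) \<and>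
     tendsto_in_prob M (\<lambda>n d. unif_moment 1 (snd d)) (measure_pmf.expectation Dr real)"

definition regular_ii :: "(nat \<Rightarrow> degree_seq pmf) \<Rightarrow> nat pmf \<Rightarrow> nat pmf \<Rightarrow> bool" where
  "regular_ii M Dl Dr \<longleftrightarrow>
     integrable Dl (\<lambda>k. real k ^ 2) \<and> integrable Dr (\<lambda>k. real k ^ 2) \<and>
     tendsto_in_prob M (\<lambda>n d. unif_moment 2 (fst d))
       (measure_pmf.expectation Dl (\<lambda>k. real k ^ 2)) \<and>
     tendsto_in_prob M (\<lambda>n d. unif_moment 2 (snd d))
       (measure_pmf.expectation Dr (\<lambda>k. real k ^ 2))"

end

theory Submission
  imports Defs
begin

text \<open>
  First assertion: both conditional laws are the uniform distribution on the same finite set, the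
  graphs with degree sequence \<open>d\<close> that come from a list of distinct groups
  (\<open>group_graphs_with n d\<close>). In the generalized random graph the odds of a group of size \<open>k\<close>
  are \<open>f(k) / \<ell>\<^sup>k\<^sup>-\<^sup>1\<close> times the product of the weights of its members, and the probability that
  exactly the groups in \<open>A\<close> are ON is a constant times the product of their odds. In that product the weight \<open>w\<^sub>i\<close> occurs once for every
  group containing \<open>i\<close>, so only the degrees matter (\<open>pmf_BGRG\<close>). In the configuration model
  all matchings are equally likely, and those that produce a given simple graph are exactly the
  ones obtained from a single one by permuting the half-edges at each vertex; simplicity makes
  this action free, so that their number depends on the degrees only
  (\<open>card_matchings_of_simple_graph\<close>).

  Second assertion: by the first one, the generalized random graph is a mixture over its degree
  sequence \<open>D\<close> of configuration models conditioned on being good, that is, simple with distinct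
  groups. Conditioning raises the probability of leaving \<open>\<E>\<^sub>n\<close> at most by the factor
  \<open>1 / P(BCM(D) good | D)\<close>, so it suffices to bound \<open>P(BCM(D) good | D)\<close> from below by a
  constant with high probability.

  For such a bound no limit law is needed. As all groups have at least two members, a multigraph is
  good as soon as it has neither a double edge nor a four-cycle. Let \<open>N\<close> be the number of edges and
  let the squared degrees on either side sum up to at most \<open>K N\<close>. Double edges and four-cycles
  correspond to partial matchings of half-edges with two and four pairs. Their expected numbers are
  bounded, but the events that they occur are far from independent. They do satisfy a one-sided
  substitute: containing a partial matching is negatively correlated with avoiding any family of
  partial matchings none of which conflicts with it (\<open>prob_extending_avoiding_le\<close>). This is
  what the lopsided form of the Lovasz local lemma asks for. The bad partial matchings that conflict
  with a given one must share a half-edge with it, and have total probability \<open>O(N\<^sup>-\<^sup>1\<^sup>/\<^sup>2)\<close> since a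
  single degree is at most \<open>(K N)\<^sup>1\<^sup>/\<^sup>2\<close>. The local lemma then yields the lower bound
  \<open>exp (- 128 K\<^sup>4)\<close> (\<open>prob_BCM_good_ge\<close>), and the convergence of the first and second moments
  of the degrees provides a suitable \<open>K\<close> with high probability.
\<close>

section \<open>A local lemma for negatively correlated events\<close>

definition avoiding :: "('b \<Rightarrow> 'a set) \<Rightarrow> 'b set \<Rightarrow> 'a set" where
  "avoiding A S = {\<omega>. \<forall>j\<in>S. \<omega> \<notin> A j}"

text \<open>Independence of \<open>A j\<close> from the events that are not its neighbours is used in the local lemma only
through an upper bound for the conditional probability of \<open>A j\<close> given that some of them fail. By
induction on \<open>S\<close>, the probability of \<open>A j\<close> given that the events indexed by \<open>S\<close> fail is at most \<open>2 q j\<close>: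
dropping the neighbours of \<open>j\<close> from \<open>S\<close> loses at most a factor \<open>2\<close>, since their conditional
probabilities sum up to at most \<open>1/2\<close>. All estimates are stated as products, since the event
conditioned on is known to have positive probability only in the end.\<close>

lemma lopsided_local_lemma:
  fixes P :: "'a pmf" and A :: "'b \<Rightarrow> 'a set" and q :: "'b \<Rightarrow> real"
  assumes fin: "finite J"
    and neg: "\<And>j S. j \<in> J \<Longrightarrow> S \<subseteq> J \<Longrightarrow> (\<And>k. k \<in> S \<Longrightarrow> \<not> nbr j k) \<Longrightarrow>
        measure_pmf.prob P (A j \<inter> avoiding A S) \<le> q j * measure_pmf.prob P (avoiding A S)"
    and q0: "\<And>j. j \<in> J \<Longrightarrow> 0 \<le> q j"
    and q4: "\<And>j. j \<in> J \<Longrightarrow> q j \<le> 1/4"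
    and nbrs: "\<And>j. j \<in> J \<Longrightarrow> (\<Sum>k\<in>{k \<in> J. nbr j k}. q k) \<le> 1/4"
  shows "exp (- 4 * (\<Sum>j\<in>J. q j)) \<le> measure_pmf.prob P (avoiding A J)"
proof -
  let ?P = "measure_pmf.prob P" and ?av = "avoiding A"
  have step: "?P (A j \<inter> ?av S) \<le> 2 * q j * ?P (?av S)" if "S \<subseteq> J" "j \<in> J" for S j
    using finite_subset[OF that(1) fin] that
  proof (induction S arbitrary: j rule: finite_psubset_induct)
    case (psubset S)
    define S1 where "S1 = {k \<in> S. nbr j k}"
    define S2 where "S2 = S - S1"
    have fS1: "finite S1" using psubset.hyps by (simp add: S1_def)
    \<comment> \<open>Only the neighbours S1 of j are in the way of the correlation assumption for j.\<close>
    have S: "?av S = ?av S2 - (\<Union>k\<in>S1. A k \<inter> ?av S2)"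
      by (auto simp: avoiding_def S1_def S2_def)
    have "?P (A j \<inter> ?av S) \<le> ?P (A j \<inter> ?av S2)"
      by (intro measure_pmf.finite_measure_mono) (auto simp: avoiding_def S2_def)
    also have "\<dots> \<le> q j * ?P (?av S2)"
      using psubset.prems by (intro neg) (auto simp: S1_def S2_def)
    finally have a: "?P (A j \<inter> ?av S) \<le> q j * ?P (?av S2)" .
    have b: "?P (?av S2) \<le> 2 * ?P (?av S)"
    proof (cases "S1 = {}")
      case True
      then show ?thesis by (simp add: S2_def)
    next
      case False
      have sm: "S2 \<subset> S" using False by (auto simp: S1_def S2_def)
      have "?P (\<Union>k\<in>S1. A k \<inter> ?av S2) \<le> (\<Sum>k\<in>S1. ?P (A k \<inter> ?av S2))"
        by (intro measure_pmf.finite_measure_subadditive_finite fS1) auto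
      also have "\<dots> \<le> (\<Sum>k\<in>S1. 2 * q k * ?P (?av S2))"
      proof (intro sum_mono)
        fix k assume "k \<in> S1"
        then show "?P (A k \<inter> ?av S2) \<le> 2 * q k * ?P (?av S2)"
          using psubset.prems sm by (intro psubset.IH) (auto simp: S1_def)
      qed
      also have "\<dots> = 2 * (\<Sum>k\<in>S1. q k) * ?P (?av S2)"
        by (simp add: sum_distrib_left sum_distrib_right)
      also have "\<dots> \<le> 2 * (1/4) * ?P (?av S2)"
      proof (intro mult_right_mono mult_left_mono)
        have "(\<Sum>k\<in>S1. q k) \<le> (\<Sum>k\<in>{k \<in> J. nbr j k}. q k)"
          using psubset.prems fin q0 by (intro sum_mono2) (auto simp: S1_def)
        also have "\<dots> \<le> 1/4" using nbrs psubset.prems by simp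
        finally show "(\<Sum>k\<in>S1. q k) \<le> 1/4" .
      qed auto
      finally have "?P (\<Union>k\<in>S1. A k \<inter> ?av S2) \<le> ?P (?av S2) / 2" by simp
      moreover have "?P (?av S) = ?P (?av S2) - ?P (\<Union>k\<in>S1. A k \<inter> ?av S2)"
        unfolding S by (intro measure_pmf.finite_measure_Diff) auto
      ultimately show ?thesis by simp
    qed
    have "q j * ?P (?av S2) \<le> q j * (2 * ?P (?av S))"
      using b q0 psubset.prems by (intro mult_left_mono) auto
    with a show ?case by (simp add: mult_ac)
  qed
  have "exp (- 4 * (\<Sum>j\<in>S. q j)) \<le> ?P (?av S)" if "S \<subseteq> J" for S
    using finite_subset[OF that fin] that
  proof (induction S rule: finite_induct)
    case empty
    have "?av {} = UNIV" by (auto simp: avoiding_def)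
    then show ?case by simp
  next
    case (insert j S)
    have j: "j \<in> J" and S: "S \<subseteq> J" using insert.prems by auto
    \<comment> \<open>The estimate 1 - x \<ge> exp (- 2 x), valid for 0 \<le> x \<le> 1/2, with x = 2 * q j.\<close>
    have "-(2 * q j) - 2 * (2 * q j)\<^sup>2 \<le> ln (1 - 2 * q j)"
      using q0[OF j] q4[OF j] by (intro ln_one_minus_pos_lower_bound) auto
    moreover have "2 * (2 * q j)\<^sup>2 \<le> 2 * q j"
      using mult_right_mono[OF q4[OF j], of "q j"] q0[OF j] by (simp add: power2_eq_square)
    ultimately have "- 4 * q j \<le> ln (1 - 2 * q j)" by linarith
    then have e: "exp (- 4 * q j) \<le> 1 - 2 * q j"
      using q4[OF j] by (subst (asm) ln_ge_iff) auto
    have "exp (- 4 * (\<Sum>j\<in>insert j S. q j)) = exp (- 4 * q j) * exp (- 4 * (\<Sum>j\<in>S. q j))"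
      using insert.hyps by (simp add: exp_add[symmetric] algebra_simps)
    also have "\<dots> \<le> (1 - 2 * q j) * ?P (?av S)"
      using e insert.IH S q4[OF j] by (intro mult_mono) auto
    also have "\<dots> \<le> ?P (?av S) - ?P (A j \<inter> ?av S)"
      using step[OF S j] by (simp add: algebra_simps)
    also have "\<dots> = ?P (?av S - A j \<inter> ?av S)"
      by (intro measure_pmf.finite_measure_Diff[symmetric]) auto
    also have "?av S - A j \<inter> ?av S = ?av (insert j S)" by (auto simp: avoiding_def)
    finally show ?case .
  qed
  from this[of J] show ?thesis by simp
qed

section \<open>Uniformly random bijections\<close>

text \<open>For two partial matchings: their union is not a partial matching.\<close>

definition conflict :: "('a \<times> 'b) set \<Rightarrow> ('a \<times> 'b) set \<Rightarrow> bool" where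
  "conflict M M' \<longleftrightarrow> (\<exists>(x, y)\<in>M. \<exists>(x', y')\<in>M'. (x = x') \<noteq> (y = y'))"

definition extending :: "('a \<times> 'b) set \<Rightarrow> ('a \<Rightarrow> 'b) set" where
  "extending M = {\<sigma>. \<forall>(x, y)\<in>M. \<sigma> x = y}"

definition bijections :: "'a set \<Rightarrow> 'b set \<Rightarrow> ('a \<Rightarrow> 'b) set" where
  "bijections S T = {\<sigma> \<in> S \<rightarrow>\<^sub>E T. bij_betw \<sigma> S T}"

text \<open>The permutation has to fix all points outside \<open>U \<union> V\<close>; this locality is what the proof of
\<open>card_extending_avoiding_le\<close> relies on.\<close>

lemma ex_permutation_extending:
  assumes "finite U" "finite V" "bij_betw g U V"
  obtains \<pi> where "\<pi> permutes U \<union> V" "\<And>u. u \<in> U \<Longrightarrow> \<pi> u = g u"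
proof -
  have "card ((U \<union> V) - U) = card ((U \<union> V) - V)"
    using assms bij_betw_same_card[OF assms(3)] by (simp add: card_Diff_subset)
  then obtain h where h: "bij_betw h ((U \<union> V) - U) ((U \<union> V) - V)"
    using assms by (metis finite_Diff finite_UnI finite_same_card_bij)
  define k where "k = (\<lambda>x. if x \<in> U then g x else h x)"
  have b1: "bij_betw k U V" using assms(3) by (subst bij_betw_cong[where g = g]) (auto simp: k_def)
  have b2: "bij_betw k ((U \<union> V) - U) ((U \<union> V) - V)"
    using h by (subst bij_betw_cong[where g = h]) (auto simp: k_def)
  have "bij_betw k (U \<union> (U \<union> V - U)) (V \<union> (U \<union> V - V))"
    by (intro bij_betw_combine[OF b1 b2]) auto
  moreover have "U \<union> (U \<union> V - U) = U \<union> V" "V \<union> (U \<union> V - V) = U \<union> V" by auto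
  ultimately have "bij_betw k (U \<union> V) (U \<union> V)" by simp
  then have "bij_betw (\<lambda>x. if x \<in> U \<union> V then k x else x) (U \<union> V) (U \<union> V)"
    by (subst bij_betw_cong[where g = k]) auto
  then have "(\<lambda>x. if x \<in> U \<union> V then k x else x) permutes U \<union> V"
    by (intro bij_imp_permutes) auto
  then show ?thesis by (rule that) (auto simp: k_def)
qed

lemma finite_bijections: "finite S \<Longrightarrow> finite T \<Longrightarrow> finite (bijections S T)"
  unfolding bijections_def by (rule finite_subset[OF _ finite_PiE[of S "\<lambda>_. T"]]) auto

text \<open>Prescribing the values on the domain of \<open>M\<close> by \<open>M\<close> itself is the least favourable choice for
avoiding partial matchings that do not conflict with \<open>M\<close>. To see this, follow \<open>\<sigma>\<close> by a permutation \<open>\<pi>\<close>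
that turns the values prescribed by \<open>M\<close> into those prescribed by \<open>\<phi>\<close> and moves nothing else than
needed. If the result extends \<open>M'\<close>, then so does \<open>\<sigma>\<close>: a pair of \<open>M'\<close> either belongs to \<open>M\<close>, or
shares no point with \<open>M\<close>, and then its second point is fixed by \<open>\<pi>\<close>. Hence \<open>\<sigma> \<mapsto> \<pi> \<circ> \<sigma>\<close> preserves
avoidance.\<close>

lemma card_extending_avoiding_le:
  assumes S: "finite S" and T: "finite T"
    and M: "M \<subseteq> S \<times> T" "inj_on fst M" "inj_on snd M"
    and nc: "\<And>M'. M' \<in> \<M> \<Longrightarrow> \<not> conflict M M'"
    and \<phi>: "\<phi> \<in> fst ` M \<rightarrow>\<^sub>E T" "inj_on \<phi> (fst ` M)"
  defines "F \<equiv> bijections S T \<inter> avoiding extending \<M>"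
  shows "card (F \<inter> extending M) \<le> card {\<sigma> \<in> F. restrict \<sigma> (fst ` M) = \<phi>}"
proof -
  have finM: "finite M" using M S T by (meson finite_SigmaI finite_subset)
  have Mimp: "y = y'" if "(x, y) \<in> M" "(x, y') \<in> M" for x y y'
    using inj_onD[OF M(2) _ that] by simp
  define m where "m = (\<lambda>t. fst (the_inv_into M snd t))"
  have m: "m t = s" if "(s, t) \<in> M" for s t
    using the_inv_into_f_f[OF M(3) that] by (simp add: m_def)
  have bm: "bij_betw (\<phi> \<circ> m) (snd ` M) (\<phi> ` fst ` M)"
  proof (intro bij_betw_trans[of m _ "fst ` M"] bij_betw_imageI \<phi>(2) refl)
    show "inj_on m (snd ` M)"
      using M(2) by (auto simp: inj_on_def m) (metis fst_conv snd_conv M(2) inj_onD)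
    show "m ` snd ` M = fst ` M"
      by (force simp: m image_iff)
  qed
  obtain \<pi> where \<pi>: "\<pi> permutes snd ` M \<union> \<phi> ` fst ` M" and \<pi>M: "\<And>u. u \<in> snd ` M \<Longrightarrow> \<pi> u = (\<phi> \<circ> m) u"
    using ex_permutation_extending[OF _ _ bm] finM by auto
  have sub: "snd ` M \<union> \<phi> ` fst ` M \<subseteq> T" using M(1) \<phi>(1) by auto
  have \<pi>T: "\<pi> permutes T" by (rule permutes_subset[OF \<pi> sub])
  have inj\<pi>: "inj \<pi>" by (rule permutes_inj[OF \<pi>])
  define \<Phi> where "\<Phi> = (\<lambda>\<sigma>. restrict (\<pi> \<circ> \<sigma>) S)"
  have \<Phi>M: "\<Phi> \<sigma> s = \<phi> s" if "\<sigma> \<in> F \<inter> extending M" "s \<in> fst ` M" for \<sigma> s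
  proof -
    from that(2) obtain t where st: "(s, t) \<in> M" by auto
    then have "s \<in> S" "\<sigma> s = t" using that(1) M(1) by (auto simp: extending_def)
    moreover have "t \<in> snd ` M" using st by force
    ultimately show ?thesis using \<pi>M[of t] m[OF st] by (simp add: \<Phi>_def)
  qed
  have maps: "\<Phi> \<sigma> \<in> {\<sigma> \<in> F. restrict \<sigma> (fst ` M) = \<phi>}" if \<sigma>: "\<sigma> \<in> F \<inter> extending M" for \<sigma>
  proof -
    have b\<sigma>: "bij_betw \<sigma> S T" using \<sigma> by (simp add: F_def bijections_def)
    have "bij_betw (\<pi> \<circ> \<sigma>) S T"
      using b\<sigma> permutes_imp_bij[OF \<pi>T] by (rule bij_betw_trans)
    then have "bij_betw (\<Phi> \<sigma>) S T" by (subst bij_betw_cong[where g = "\<pi> \<circ> \<sigma>"]) (auto simp: \<Phi>_def)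
    then have "\<Phi> \<sigma> \<in> bijections S T"
      by (auto simp: bijections_def \<Phi>_def dest: bij_betwE)
    moreover have "\<Phi> \<sigma> \<in> avoiding extending \<M>"
    proof (rule ccontr)
      assume "\<Phi> \<sigma> \<notin> avoiding extending \<M>"
      then obtain M' where M': "M' \<in> \<M>" "\<Phi> \<sigma> \<in> extending M'" by (auto simp: avoiding_def)
      have "\<sigma> s = t" if st: "(s, t) \<in> M'" for s t
      proof (cases "(s, t) \<in> M")
        case True
        then show ?thesis using \<sigma> by (auto simp: extending_def)
      next
        case False
        \<comment> \<open>Since M' and M do not conflict, sharing one point would mean sharing the pair.\<close>
        have s: "s \<notin> fst ` M" and t: "t \<notin> snd ` M"
          using nc[OF M'(1)] st False unfolding conflict_def by (fastforce)+
        have \<Phi>st: "\<Phi> \<sigma> s = t" using M'(2) st by (auto simp: extending_def)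
        show ?thesis
        proof (cases "s \<in> S")
          case True
          have "\<sigma> s \<notin> snd ` M"
          proof
            assume "\<sigma> s \<in> snd ` M"
            then obtain s' where s': "(s', \<sigma> s) \<in> M" by auto
            then have "\<sigma> s' = \<sigma> s" "s' \<in> S" using \<sigma> M(1) by (auto simp: extending_def)
            then have "s' = s" using b\<sigma> True by (auto simp: bij_betw_def dest: inj_onD)
            then show False using s s' by force
          qed
          moreover have "t \<notin> \<phi> ` fst ` M"
          proof
            assume "t \<in> \<phi> ` fst ` M"
            then obtain s' t' where s': "(s', t') \<in> M" "\<phi> s' = t" by auto
            then have "\<sigma> s' = t'" using \<sigma> by (auto simp: extending_def)
            have "t' \<in> snd ` M" using s' by force
            then have "\<pi> t' = t" using \<pi>M m s' by auto
            then have "\<pi> t' = \<pi> (\<sigma> s)" using \<Phi>st True by (simp add: \<Phi>_def)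
            then have "t' = \<sigma> s" by (rule injD[OF inj\<pi>])
            then show False using \<open>\<sigma> s \<notin> snd ` M\<close> \<open>t' \<in> snd ` M\<close> by simp
          qed
          ultimately have "\<pi> t = t" using t by (intro permutes_not_in[OF \<pi>]) auto
          then have "\<pi> (\<sigma> s) = \<pi> t" using \<Phi>st True by (simp add: \<Phi>_def)
          then show ?thesis by (rule injD[OF inj\<pi>])
        next
          case False
          have "\<sigma> \<in> S \<rightarrow>\<^sub>E T" using \<sigma> by (simp add: F_def bijections_def)
          then have "\<sigma> s = undefined" using False by (rule PiE_arb)
          then show ?thesis using \<Phi>st False by (simp add: \<Phi>_def)
        qed
      qed
      then have "\<sigma> \<in> extending M'" by (auto simp: extending_def)
      then show False using M'(1) \<sigma> by (auto simp: F_def avoiding_def)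
    qed
    moreover have "restrict (\<Phi> \<sigma>) (fst ` M) = \<phi>"
    proof (rule extensionalityI[of _ "fst ` M"])
      show "\<phi> \<in> extensional (fst ` M)" using \<phi>(1) by (simp add: PiE_def)
    qed (use \<Phi>M[OF \<sigma>] in auto)
    ultimately show ?thesis by (simp add: F_def)
  qed
  have inj: "inj_on \<Phi> (F \<inter> extending M)"
  proof (rule inj_onI)
    fix \<sigma> \<tau> assume *: "\<sigma> \<in> F \<inter> extending M" "\<tau> \<in> F \<inter> extending M" "\<Phi> \<sigma> = \<Phi> \<tau>"
    show "\<sigma> = \<tau>"
    proof (rule extensionalityI[of _ S])
      fix s assume "s \<in> S"
      then have "\<pi> (\<sigma> s) = \<pi> (\<tau> s)" using fun_cong[OF *(3), of s] by (simp add: \<Phi>_def)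
      then show "\<sigma> s = \<tau> s" using inj\<pi> by (auto dest: injD)
    qed (use * in \<open>auto simp: F_def bijections_def PiE_def\<close>)
  qed
  show ?thesis
    using inj maps finite_bijections[OF S T] by (intro card_inj_on_le[of \<Phi>]) (auto simp: F_def)
qed

text \<open>Negative correlation, the input of the local lemma. The bijections in question are classified by
their restriction to the domain of \<open>M\<close>, an arbitrary injection into \<open>T\<close>; the class of \<open>M\<close> is the
smallest by \<open>card_extending_avoiding_le\<close>, and the denominator is the number of classes.\<close>

lemma prob_extending_avoiding_le:
  assumes S: "finite S" and T: "finite T" and ne: "bijections S T \<noteq> {}"
    and M: "M \<subseteq> S \<times> T" "inj_on fst M" "inj_on snd M"
    and nc: "\<And>M'. M' \<in> \<M> \<Longrightarrow> \<not> conflict M M'"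
  defines "P \<equiv> pmf_of_set (bijections S T)"
  shows "measure_pmf.prob P (extending M \<inter> avoiding extending \<M>)
    \<le> 1 / (\<Prod>i<card M. real (card T - i)) * measure_pmf.prob P (avoiding extending \<M>)"
proof -
  define F where "F = bijections S T \<inter> avoiding extending \<M>"
  define I where "I = {\<phi> \<in> fst ` M \<rightarrow>\<^sub>E T. inj_on \<phi> (fst ` M)}"
  have finM: "finite M" using M S T by (meson finite_SigmaI finite_subset)
  have finB: "finite (bijections S T)" by (rule finite_bijections[OF S T])
  then have finF: "finite F" by (simp add: F_def)
  have finI: "finite I" unfolding I_def using finM T
    by (intro finite_subset[OF _ finite_PiE[of "fst ` M" "\<lambda>_. T"]]) auto
  have cI: "card I = (\<Prod>i<card M. card T - i)"
    using card_inj_on_subset_funcset[of "fst ` M" T "fst ` M"] finM T card_image[OF M(2)]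
    by (simp add: I_def lessThan_atLeast0)
  have "card (snd ` M) \<le> card T" using M(1) T by (intro card_mono) auto
  then have le: "card M \<le> card T" by (simp add: card_image[OF M(3)])
  have "card I * card (F \<inter> extending M) = (\<Sum>\<phi>\<in>I. card (F \<inter> extending M))" by simp
  also have "\<dots> \<le> (\<Sum>\<phi>\<in>I. card {\<sigma> \<in> F. restrict \<sigma> (fst ` M) = \<phi>})"
    unfolding F_def I_def by (intro sum_mono card_extending_avoiding_le S T M nc) auto
  also have "\<dots> = card (\<Union>\<phi>\<in>I. {\<sigma> \<in> F. restrict \<sigma> (fst ` M) = \<phi>})"
    using finI finF by (intro card_UN_disjoint[symmetric]) auto
  also have "\<dots> \<le> card F" using finF by (intro card_mono) auto
  finally have "real (card I) * real (card (F \<inter> extending M)) \<le> real (card F)"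
    by (metis of_nat_le_iff of_nat_mult)
  moreover have "0 < real (card I)" using le by (auto simp: cI intro!: prod_pos)
  ultimately have "real (card (F \<inter> extending M)) \<le> 1 / real (card I) * real (card F)"
    by (simp add: field_simps)
  then have "real (card (F \<inter> extending M)) / real (card (bijections S T))
      \<le> 1 / real (card I) * real (card F) / real (card (bijections S T))"
    by (rule divide_right_mono) simp
  moreover have "bijections S T \<inter> (extending M \<inter> avoiding extending \<M>) = F \<inter> extending M"
    by (auto simp: F_def)
  ultimately show ?thesis
    unfolding P_def
    by (simp add: measure_pmf_of_set[OF ne finB] cI F_def[symmetric])
qed

section \<open>Counting double edges and four-cycles\<close>

text \<open>The relations \<open>R\<close> and \<open>R'\<close> say that two left, respectively right, half-edges belong to the same
vertex. An element of \<open>doubles\<close> is then a way to produce two parallel edges.\<close>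

definition doubles :: "('a \<times> 'a) set \<Rightarrow> ('b \<times> 'b) set \<Rightarrow> ('a \<times> 'b) set set" where
  "doubles R R' = {{(x, y), (x', y')} | x x' y y'. (x, x') \<in> R \<and> (y, y') \<in> R'}"

text \<open>The ways to produce a four-cycle: \<open>x, x'\<close> and \<open>z, z'\<close> are half-edges at two left-vertices, \<open>y, y'\<close>
and \<open>v, v'\<close> at two right-vertices, and each of these left-vertices is joined to each of these
right-vertices.\<close>

definition squares :: "('a \<times> 'a) set \<Rightarrow> ('b \<times> 'b) set \<Rightarrow> ('a \<times> 'b) set set" where
  "squares R R' = {{(x, y), (x', v), (z, y'), (z', v')} | x x' z z' y y' v v'.
     (x, x') \<in> R \<and> (z, z') \<in> R \<and> (y, y') \<in> R' \<and> (v, v') \<in> R' \<and>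
     distinct [x, x', z, z'] \<and> distinct [y, y', v, v']}"

lemma squaresI:
  assumes "(x, x') \<in> R" "(z, z') \<in> R" "(y, y') \<in> R'" "(v, v') \<in> R'"
    and "distinct [x, x', z, z']" "distinct [y, y', v, v']"
    and "M = {(x, y), (x', v), (z, y'), (z', v')}"
  shows "M \<in> squares R R'"
  unfolding squares_def using assms by blast

lemma converse_doubles: "M \<in> doubles R R' \<Longrightarrow> M\<inverse> \<in> doubles R' R"
proof -
  assume "M \<in> doubles R R'"
  then obtain x x' y y' where M: "M = {(x, y), (x', y')}" "(x, x') \<in> R" "(y, y') \<in> R'"
    unfolding doubles_def by auto
  then have "M\<inverse> = {(y, x), (y', x')}" by auto
  then show ?thesis unfolding doubles_def using M by auto
qed

lemma converse_squares: "M \<in> squares R R' \<Longrightarrow> M\<inverse> \<in> squares R' R"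
proof -
  assume "M \<in> squares R R'"
  then obtain x x' z z' y y' v v' where M: "M = {(x, y), (x', v), (z, y'), (z', v')}"
    "(x, x') \<in> R" "(z, z') \<in> R" "(y, y') \<in> R'" "(v, v') \<in> R'"
    "distinct [x, x', z, z']" "distinct [y, y', v, v']"
    unfolding squares_def by auto
  have "M\<inverse> = {(y, x), (y', z), (v, x'), (v', z')}" using M(1) by auto
  then show ?thesis by (rule squaresI[OF M(4,5,2,3,7,6)])
qed

lemma card_doubles_le:
  assumes "finite R" "finite R'"
  shows "finite (doubles R R')" "card (doubles R R') \<le> card R * card R'"
proof -
  let ?f = "\<lambda>((x, x'), (y, y')). {(x, y), (x', y')}"
  have sub: "doubles R R' \<subseteq> ?f ` (R \<times> R')"
  proof
    fix M assume "M \<in> doubles R R'"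
    then obtain x x' y y' where "M = {(x, y), (x', y')}" "(x, x') \<in> R" "(y, y') \<in> R'"
      unfolding doubles_def by auto
    then show "M \<in> ?f ` (R \<times> R')" by (intro image_eqI[of _ _ "((x, x'), (y, y'))"]) auto
  qed
  have fin: "finite (R \<times> R')" using assms by simp
  show "finite (doubles R R')" using sub fin by (meson finite_imageI finite_subset)
  have "card (doubles R R') \<le> card (R \<times> R')"
    using sub fin by (meson card_image_le card_mono finite_imageI order_trans)
  then show "card (doubles R R') \<le> card R * card R'" by (simp add: card_cartesian_product)
qed

lemma card_squares_le:
  assumes "finite R" "finite R'"
  shows "finite (squares R R')" "card (squares R R') \<le> card R ^ 2 * card R' ^ 2"
proof -
  let ?f = "\<lambda>(((x, x'), (z, z')), ((y, y'), (v, v'))). {(x, y), (x', v), (z, y'), (z', v')}"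
  let ?D = "(R \<times> R) \<times> (R' \<times> R')"
  have sub: "squares R R' \<subseteq> ?f ` ?D"
  proof
    fix M assume "M \<in> squares R R'"
    then obtain x x' z z' y y' v v' where "M = {(x, y), (x', v), (z, y'), (z', v')}"
      "(x, x') \<in> R" "(z, z') \<in> R" "(y, y') \<in> R'" "(v, v') \<in> R'"
      unfolding squares_def by auto
    then show "M \<in> ?f ` ?D"
      by (intro image_eqI[of _ _ "(((x, x'), (z, z')), ((y, y'), (v, v')))"]) auto
  qed
  have fin: "finite ?D" using assms by simp
  show "finite (squares R R')" using sub fin by (meson finite_imageI finite_subset)
  have "card (squares R R') \<le> card ?D"
    using sub fin by (meson card_image_le card_mono finite_imageI order_trans)
  then show "card (squares R R') \<le> card R ^ 2 * card R' ^ 2"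
    by (simp add: card_cartesian_product power2_eq_square mult_ac)
qed

text \<open>By symmetry of \<open>R\<close> and \<open>R'\<close> the given half-edge may be assumed to be the one called \<open>x\<close> in the
definition, which leaves the choice of its partner and of a pair in \<open>R'\<close>.\<close>

lemma card_doubles_through_le:
  assumes fin: "finite R" "finite R'" and sym: "sym R" "sym R'"
  shows "card {M \<in> doubles R R'. x \<in> fst ` M} \<le> card (R `` {x}) * card R'"
proof -
  let ?f = "\<lambda>(x', (y, y')). {(x, y), (x', y')}"
  have "{M \<in> doubles R R'. x \<in> fst ` M} \<subseteq> ?f ` ((R `` {x}) \<times> R')"
  proof
    fix M assume "M \<in> {M \<in> doubles R R'. x \<in> fst ` M}"
    then obtain x1 x1' y y' where M: "M = {(x1, y), (x1', y')}"
      and *: "(x1, x1') \<in> R" "(y, y') \<in> R'" "x = x1 \<or> x = x1'"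
      by (auto simp: doubles_def)
    from *(3) show "M \<in> ?f ` ((R `` {x}) \<times> R')"
    proof
      assume "x = x1"
      then show ?thesis using * M by (intro image_eqI[of _ _ "(x1', (y, y'))"]) auto
    next
      assume x: "x = x1'"
      show ?thesis
        by (rule image_eqI[of _ _ "(x1, (y', y))"]) (use * M x sym in \<open>auto dest: symD simp: insert_commute\<close>)
    qed
  qed
  moreover have f: "finite ((R `` {x}) \<times> R')" using fin by (simp add: finite_Image)
  ultimately have "card {M \<in> doubles R R'. x \<in> fst ` M} \<le> card ((R `` {x}) \<times> R')"
    by (meson card_image_le card_mono finite_imageI order_trans)
  then show ?thesis by (simp add: card_cartesian_product)
qed

text \<open>All four left half-edges of a four-cycle play the same role, because \<open>R\<close> and \<open>R'\<close> are symmetric and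
the two left-vertices, as well as the two right-vertices, may be interchanged.\<close>

lemma card_squares_through_le:
  assumes fin: "finite R" "finite R'" and sym: "sym R" "sym R'"
  shows "card {M \<in> squares R R'. x \<in> fst ` M} \<le> card (R `` {x}) * (card R * card R' ^ 2)"
proof -
  let ?f = "\<lambda>(x', ((z, z'), ((y, y'), (v, v')))). {(x, y), (x', v), (z, y'), (z', v')}"
  let ?D = "(R `` {x}) \<times> (R \<times> (R' \<times> R'))"
  have "{M \<in> squares R R'. x \<in> fst ` M} \<subseteq> ?f ` ?D"
  proof
    fix M assume "M \<in> {M \<in> squares R R'. x \<in> fst ` M}"
    then obtain x1 x1' z z' y y' v v' where M: "M = {(x1, y), (x1', v), (z, y'), (z', v')}"
      and *: "(x1, x1') \<in> R" "(z, z') \<in> R" "(y, y') \<in> R'" "(v, v') \<in> R'"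
      and x: "x = x1 \<or> x = x1' \<or> x = z \<or> x = z'"
      by (auto simp: squares_def)
    have s: "(x1', x1) \<in> R" "(z', z) \<in> R" "(y', y) \<in> R'" "(v', v) \<in> R'"
      using * sym by (auto dest: symD)
    from x show "M \<in> ?f ` ?D"
    proof (elim disjE)
      assume "x = x1"
      then show ?thesis using * M
        by (intro image_eqI[of _ _ "(x1', ((z, z'), ((y, y'), (v, v'))))"]) auto
    next
      assume "x = x1'"
      then show ?thesis using * s M
        by (intro image_eqI[of _ _ "(x1, ((z', z), ((v, v'), (y, y'))))"]) (auto simp: insert_commute)
    next
      assume "x = z"
      then show ?thesis using * s M
        by (intro image_eqI[of _ _ "(z', ((x1, x1'), ((y', y), (v', v))))"]) (auto simp: insert_commute)
    next
      assume "x = z'"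
      then show ?thesis using * s M
        by (intro image_eqI[of _ _ "(z, ((x1', x1), ((v', v), (y', y))))"]) (auto simp: insert_commute)
    qed
  qed
  moreover have f: "finite ?D" using fin by (simp add: finite_Image)
  ultimately have "card {M \<in> squares R R'. x \<in> fst ` M} \<le> card ?D"
    by (meson card_image_le card_mono finite_imageI order_trans)
  then show ?thesis by (simp add: card_cartesian_product power2_eq_square)
qed

text \<open>Reduces statements about right half-edges to statements about left half-edges.\<close>

lemma card_through_snd_le:
  fixes \<X> :: "('a \<times> 'b) set set"
  assumes "\<And>M. M \<in> \<X> \<Longrightarrow> M\<inverse> \<in> \<Y>" "finite \<Y>"
  shows "card {M \<in> \<X>. y \<in> snd ` M} \<le> card {M \<in> \<Y>. y \<in> fst ` M}"
proof (rule card_inj_on_le[where f = converse])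
  show "inj_on converse {M \<in> \<X>. y \<in> snd ` M}" by (auto intro!: inj_onI)
  show "converse ` {M \<in> \<X>. y \<in> snd ` M} \<subseteq> {M \<in> \<Y>. y \<in> fst ` M}"
    using assms(1) by (force simp: image_iff)
qed (use assms(2) in auto)

lemma partial_matching_doubles:
  assumes "M \<in> doubles R R'" "irrefl R" "irrefl R'" "R \<subseteq> S \<times> S" "R' \<subseteq> T \<times> T"
  shows "M \<subseteq> S \<times> T" "inj_on fst M" "inj_on snd M" "card M = 2"
proof -
  obtain x x' y y' where M: "M = {(x, y), (x', y')}" "(x, x') \<in> R" "(y, y') \<in> R'"
    using assms(1) unfolding doubles_def by auto
  have "x \<noteq> x'" "y \<noteq> y'" using M(2,3) assms(2,3) by (auto simp: irrefl_def)
  then show "inj_on fst M" "inj_on snd M" "card M = 2" by (auto simp: M(1))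
  show "M \<subseteq> S \<times> T" using M assms by auto
qed

lemma partial_matching_squares:
  assumes "M \<in> squares R R'" "R \<subseteq> S \<times> S" "R' \<subseteq> T \<times> T"
  shows "M \<subseteq> S \<times> T" "inj_on fst M" "inj_on snd M" "card M = 4"
proof -
  obtain x x' z z' y y' v v' where M: "M = {(x, y), (x', v), (z, y'), (z', v')}"
    "(x, x') \<in> R" "(z, z') \<in> R" "(y, y') \<in> R'" "(v, v') \<in> R'"
    "distinct [x, x', z, z']" "distinct [y, y', v, v']"
    using assms(1) unfolding squares_def by auto
  show "M \<subseteq> S \<times> T" using M assms by auto
  show "inj_on fst M" "inj_on snd M" "card M = 4" using M(6,7) by (auto simp: M(1))
qed

section \<open>Avoiding all double edges and four-cycles\<close>

lemma inverse_falling_le: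
  fixes N :: nat
  assumes "8 \<le> N" 
  shows "1 / (\<Prod>i<2. real (N - i)) \<le> 16 / real N ^ 2"
    and "1 / (\<Prod>i<4. real (N - i)) \<le> 16 / real N ^ 4"
    and "0 < (\<Prod>i<2. real (N - i))" and "0 < (\<Prod>i<4. real (N - i))"
proof -
  have *: "(real N / 2) ^ k \<le> (\<Prod>i<k. real (N - i))" if "k \<le> 4" for k
  proof -
    have "(\<Prod>i<k. real N / 2) \<le> (\<Prod>i<k. real (N - i))"
      using assms that by (intro prod_mono) auto
    then show ?thesis by simp
  qed
  have N: "0 < real N" using assms by simp
  show p: "0 < (\<Prod>i<2. real (N - i))" "0 < (\<Prod>i<4. real (N - i))"
    using assms by (auto intro!: prod_pos)
  show "1 / (\<Prod>i<4. real (N - i)) \<le> 16 / real N ^ 4"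
    using *[of 4] p(2) N by (simp add: field_simps)
  have "real N ^ 2 \<le> 4 * (\<Prod>i<2. real (N - i))" using *[of 2] by (simp add: power_divide)
  then have "real N ^ 2 \<le> 16 * (\<Prod>i<2. real (N - i))" using p(1) by linarith
  then show "1 / (\<Prod>i<2. real (N - i)) \<le> 16 / real N ^ 2"
    using p(1) N by (simp add: field_simps)
qed

lemma sum_UN_le:
  fixes f :: "'b \<Rightarrow> real"
  assumes "finite I" "\<And>i. i \<in> I \<Longrightarrow> finite (A i)" "\<And>x. 0 \<le> f x"
  shows "sum f (\<Union>i\<in>I. A i) \<le> (\<Sum>i\<in>I. sum f (A i))"
  using assms
proof (induction I rule: finite_induct)
  case (insert i I)
  have "sum f (A i \<union> (\<Union>i\<in>I. A i)) \<le> sum f (A i) + sum f (\<Union>i\<in>I. A i)"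
    using insert by (subst sum_Un) (auto intro!: sum_nonneg)
  then show ?case using insert by fastforce
qed simp

text \<open>The local lemma with one event for every double edge and every four-cycle. Double edges number at
most \<open>(K N)\<^sup>2\<close> and have probability of order \<open>N\<^sup>-\<^sup>2\<close>; four-cycles number at most \<open>(K N)\<^sup>4\<close> and have
probability of order \<open>N\<^sup>-\<^sup>4\<close>. So the total probability is bounded. Fixing one half-edge replaces one
factor \<open>K N\<close> by the bound \<open>D\<close> for a single degree, which makes the total probability of the events
in conflict with a given one small.\<close>

lemma avoiding_doubles_squares:
  fixes R :: "('a \<times> 'a) set" and R' :: "('b \<times> 'b) set" and K D :: real
  assumes S: "finite S" "card S = N" and T: "finite T" "card T = N" and N: "8 \<le> N"
    and R: "R \<subseteq> S \<times> S" "sym R" "irrefl R" and R': "R' \<subseteq> T \<times> T" "sym R'" "irrefl R'"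
    and cR: "card R \<le> K * N" and cR': "card R' \<le> K * N" and K: "1 \<le> K"
    and D: "\<And>x. card (R `` {x}) \<le> D" "\<And>y. card (R' `` {y}) \<le> D" "1024 * K ^ 3 * D \<le> N"
  shows "exp (- 128 * K ^ 4) \<le> measure_pmf.prob (pmf_of_set (bijections S T))
    (avoiding extending (doubles R R' \<union> squares R R'))"
proof -
  define q :: "('a \<times> 'b) set \<Rightarrow> real" where
    "q = (\<lambda>M. 1 / (\<Prod>i<card M. real (N - i)))"
  define J where "J = doubles R R' \<union> squares R R'"
  have finR: "finite R" "finite R'" using R R' S T by (auto intro: finite_subset)
  have Npos: "0 < real N" using N by simp
  have finJ: "finite J" unfolding J_def using card_doubles_le(1) card_squares_le(1) finR by blast
  have ne: "bijections S T \<noteq> {}"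
  proof -
    obtain h where "bij_betw h S T" using S T by (metis finite_same_card_bij)
    then have "restrict h S \<in> bijections S T"
      by (auto simp: bijections_def bij_betw_restrict_eq dest: bij_betwE)
    then show ?thesis by auto
  qed
  have J: "M \<subseteq> S \<times> T" "inj_on fst M" "inj_on snd M" "card M = 2 \<or> card M = 4" if "M \<in> J" for M
  proof -
    have "M \<subseteq> S \<times> T \<and> inj_on fst M \<and> inj_on snd M \<and> (card M = 2 \<or> card M = 4)"
    proof (cases "M \<in> doubles R R'")
      case True
      note pm = partial_matching_doubles[OF True R(3) R'(3) R(1) R'(1)]
      show ?thesis by (intro conjI pm disjI1)
    next
      case False
      then have "M \<in> squares R R'" using that by (simp add: J_def)
      note pm = partial_matching_squares[OF this R(1) R'(1)]
      show ?thesis by (intro conjI pm disjI2)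
    qed
    then show "M \<subseteq> S \<times> T" "inj_on fst M" "inj_on snd M" "card M = 2 \<or> card M = 4" by auto
  qed
  have q0: "0 \<le> q M" for M by (auto simp: q_def intro!: divide_nonneg_nonneg prod_nonneg)
  have q2: "q M \<le> 16 / real N ^ 2" if "M \<in> doubles R R'" for M
    using partial_matching_doubles(4)[OF that R(3) R'(3) R(1) R'(1)] inverse_falling_le(1)[OF N]
    by (simp add: q_def)
  have q4: "q M \<le> 16 / real N ^ 4" if "M \<in> squares R R'" for M
    using partial_matching_squares(4)[OF that R(1) R'(1)] inverse_falling_le(2)[OF N]
    by (simp add: q_def)
  have q_sum: "(\<Sum>M\<in>{M \<in> J. Q M}. q M) \<le>
      card {M \<in> doubles R R'. Q M} * (16 / real N ^ 2) + card {M \<in> squares R R'. Q M} * (16 / real N ^ 4)" for Q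
  proof -
    have fin: "finite {M \<in> doubles R R'. Q M}" "finite {M \<in> squares R R'. Q M}"
      by (simp_all add: card_doubles_le(1) card_squares_le(1) finR)
    have "{M \<in> J. Q M} = {M \<in> doubles R R'. Q M} \<union> {M \<in> squares R R'. Q M}"
      by (auto simp: J_def)
    then have "(\<Sum>M\<in>{M \<in> J. Q M}. q M) \<le> (\<Sum>M\<in>{M \<in> doubles R R'. Q M}. q M) + (\<Sum>M\<in>{M \<in> squares R R'. Q M}. q M)"
      using fin q0 by (simp add: sum_Un sum_nonneg)
    also have "\<dots> \<le> (\<Sum>M\<in>{M \<in> doubles R R'. Q M}. 16 / real N ^ 2) + (\<Sum>M\<in>{M \<in> squares R R'. Q M}. 16 / real N ^ 4)"
      by (intro add_mono sum_mono q2 q4) auto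
    finally show ?thesis by simp
  qed
  have D0: "0 \<le> D" using D(1)[of undefined] by (meson of_nat_0_le_iff order_trans)
  \<comment> \<open>A partial matching has at most 4 + 4 half-edges, so 1/32 for each of them makes the total
    weight of its conflicts at most 1/4.\<close>
  have through_bound: "real c2 * (16 / real N ^ 2) + real c4 * (16 / real N ^ 4) \<le> 1/32"
    if "real c2 \<le> D * (K * N)" "real c4 \<le> D * ((K * N) * (K * N) ^ 2)" for c2 c4 :: nat
  proof -
    have "real c2 * (16 / real N ^ 2) + real c4 * (16 / real N ^ 4)
      \<le> D * (K * N) * (16 / real N ^ 2) + D * ((K * N) * (K * N) ^ 2) * (16 / real N ^ 4)"
      using that by (intro add_mono mult_right_mono) auto
    also have "\<dots> = 16 * (K + K ^ 3) * D / N"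
      using Npos by (simp add: field_simps power2_eq_square power3_eq_cube power4_eq_xxxx)
    also have "\<dots> \<le> 16 * (2 * K ^ 3) * D / N"
      using K D0 self_le_power[of K 3] by (intro divide_right_mono mult_right_mono) auto
    also have "\<dots> \<le> 1/32"
      using D(3) Npos by (simp add: field_simps)
    finally show ?thesis .
  qed
  have KN: "0 \<le> K * N" using K by simp
  have throughL: "(\<Sum>M\<in>{M \<in> J. x \<in> fst ` M}. q M) \<le> 1/32" for x
  proof (rule order_trans[OF q_sum through_bound])
    have "real (card {M \<in> doubles R R'. x \<in> fst ` M}) \<le> real (card (R `` {x})) * real (card R')"
      using of_nat_mono[OF card_doubles_through_le[OF finR R(2) R'(2), of x], where 'a = real] by simp
    also have "\<dots> \<le> D * (K * N)" using D0 by (intro mult_mono D cR') auto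
    finally show "real (card {M \<in> doubles R R'. x \<in> fst ` M}) \<le> D * (K * N)" .
    have "real (card {M \<in> squares R R'. x \<in> fst ` M})
        \<le> real (card (R `` {x})) * (real (card R) * real (card R') ^ 2)"
      using of_nat_mono[OF card_squares_through_le[OF finR R(2) R'(2), of x], where 'a = real] by simp
    also have "\<dots> \<le> D * ((K * N) * (K * N) ^ 2)"
      using D0 KN by (intro mult_mono D cR cR' power_mono) auto
    finally show "real (card {M \<in> squares R R'. x \<in> fst ` M}) \<le> D * ((K * N) * (K * N) ^ 2)" .
  qed
  have throughR: "(\<Sum>M\<in>{M \<in> J. y \<in> snd ` M}. q M) \<le> 1/32" for y
  proof (rule order_trans[OF q_sum through_bound])
    have "card {M \<in> doubles R R'. y \<in> snd ` M} \<le> card {M \<in> doubles R' R. y \<in> fst ` M}"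
      by (intro card_through_snd_le converse_doubles card_doubles_le finR)
    also have "\<dots> \<le> card (R' `` {y}) * card R"
      by (rule card_doubles_through_le[OF finR(2,1) R'(2) R(2)])
    finally have "real (card {M \<in> doubles R R'. y \<in> snd ` M}) \<le> real (card (R' `` {y})) * real (card R)"
      by (simp flip: of_nat_mult)
    also have "\<dots> \<le> D * (K * N)" using D0 by (intro mult_mono D cR) auto
    finally show "real (card {M \<in> doubles R R'. y \<in> snd ` M}) \<le> D * (K * N)" .
    have "card {M \<in> squares R R'. y \<in> snd ` M} \<le> card {M \<in> squares R' R. y \<in> fst ` M}"
      by (intro card_through_snd_le converse_squares card_squares_le finR)
    also have "\<dots> \<le> card (R' `` {y}) * (card R' * card R ^ 2)"
      by (rule card_squares_through_le[OF finR(2,1) R'(2) R(2)])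
    finally have "real (card {M \<in> squares R R'. y \<in> snd ` M})
        \<le> real (card (R' `` {y})) * (real (card R') * real (card R) ^ 2)"
      by (simp flip: of_nat_mult of_nat_power)
    also have "\<dots> \<le> D * ((K * N) * (K * N) ^ 2)"
      using D0 KN by (intro mult_mono D cR cR' power_mono) auto
    finally show "real (card {M \<in> squares R R'. y \<in> snd ` M}) \<le> D * ((K * N) * (K * N) ^ 2)" .
  qed
  have "exp (- 4 * (\<Sum>M\<in>J. q M)) \<le> measure_pmf.prob (pmf_of_set (bijections S T)) (avoiding extending J)"
  proof (rule lopsided_local_lemma[where nbr = conflict])
    fix M \<S> assume M: "M \<in> J" and "\<S> \<subseteq> J" "\<And>M'. M' \<in> \<S> \<Longrightarrow> \<not> conflict M M'"
    then show "measure_pmf.prob (pmf_of_set (bijections S T)) (extending M \<inter> avoiding extending \<S>)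
      \<le> q M * measure_pmf.prob (pmf_of_set (bijections S T)) (avoiding extending \<S>)"
      unfolding q_def T(2)[symmetric] using J[OF M] by (intro prob_extending_avoiding_le S T ne)
  next
    fix M assume M: "M \<in> J"
    have N64: "64 \<le> real N ^ 2" using N power_mono[of 8 "real N" 2] by simp
    have "16 / real N ^ 2 \<le> 1/4" using N64 Npos by (simp add: field_simps)
    moreover have "16 / real N ^ 4 \<le> 16 / real N ^ 2"
      using N by (intro divide_left_mono power_increasing mult_pos_pos) auto
    ultimately show "q M \<le> 1/4" using q2 q4 M unfolding J_def by fastforce
  next
    fix M assume M: "M \<in> J"
    have fM: "finite M" "card M \<le> 4" using J(4)[OF M] card.infinite[of M] by fastforce+
    have sub: "{M' \<in> J. conflict M M'} \<subseteq>
        (\<Union>x\<in>fst ` M. {M' \<in> J. x \<in> fst ` M'}) \<union> (\<Union>y\<in>snd ` M. {M' \<in> J. y \<in> snd ` M'})"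
      unfolding conflict_def by force
    have "(\<Sum>M'\<in>{M' \<in> J. conflict M M'}. q M')
      \<le> (\<Sum>M'\<in>(\<Union>x\<in>fst ` M. {M' \<in> J. x \<in> fst ` M'}) \<union> (\<Union>y\<in>snd ` M. {M' \<in> J. y \<in> snd ` M'}). q M')"
      using fM finJ q0 by (intro sum_mono2[OF _ sub]) auto
    also have "\<dots> \<le> (\<Sum>M'\<in>(\<Union>x\<in>fst ` M. {M' \<in> J. x \<in> fst ` M'}). q M') + (\<Sum>M'\<in>(\<Union>y\<in>snd ` M. {M' \<in> J. y \<in> snd ` M'}). q M')"
      using fM finJ q0 by (subst sum_Un) (auto intro!: sum_nonneg)
    also have "\<dots> \<le> (\<Sum>x\<in>fst ` M. \<Sum>M'\<in>{M' \<in> J. x \<in> fst ` M'}. q M') + (\<Sum>y\<in>snd ` M. \<Sum>M'\<in>{M' \<in> J. y \<in> snd ` M'}. q M')"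
      using fM finJ q0 by (intro add_mono sum_UN_le) auto
    also have "\<dots> \<le> (\<Sum>x\<in>fst ` M. 1/32) + (\<Sum>y\<in>snd ` M. 1/32)"
      by (intro add_mono sum_mono throughL throughR)
    also have "\<dots> \<le> 1/4"
      using card_image_le[OF fM(1), of fst] card_image_le[OF fM(1), of snd] fM(2) by simp
    finally show "(\<Sum>M'\<in>{M' \<in> J. conflict M M'}. q M') \<le> 1/4" .
  qed (auto simp: finJ q0)
  moreover have "(\<Sum>M\<in>J. q M) \<le> 32 * K ^ 4"
  proof -
    have "(\<Sum>M\<in>J. q M) \<le> card (doubles R R') * (16 / real N ^ 2) + card (squares R R') * (16 / real N ^ 4)"
      using q_sum[of "\<lambda>_. True"] by simp
    also have "\<dots> \<le> ((K * N) * (K * N)) * (16 / real N ^ 2) + ((K * N) ^ 2 * (K * N) ^ 2) * (16 / real N ^ 4)"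
    proof (intro add_mono mult_right_mono)
      have "real (card (doubles R R')) \<le> real (card R) * real (card R')"
        using card_doubles_le(2)[OF finR] by (metis of_nat_le_iff of_nat_mult)
      also have "\<dots> \<le> (K * N) * (K * N)" using KN by (intro mult_mono cR cR') auto
      finally show "real (card (doubles R R')) \<le> (K * N) * (K * N)" .
      have "real (card (squares R R')) \<le> real (card R) ^ 2 * real (card R') ^ 2"
        using card_squares_le(2)[OF finR] by (metis of_nat_le_iff of_nat_mult of_nat_power)
      also have "\<dots> \<le> (K * N) ^ 2 * (K * N) ^ 2" using KN by (intro mult_mono power_mono cR cR') auto
      finally show "real (card (squares R R')) \<le> (K * N) ^ 2 * (K * N) ^ 2" .
    qed auto
    also have "\<dots> = 16 * (K ^ 2 + K ^ 4)"
      using Npos by (simp add: field_simps power2_eq_square power4_eq_xxxx)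
    also have "\<dots> \<le> 32 * K ^ 4" using power_increasing[of 2 4 K] K by simp
    finally show ?thesis .
  qed
  ultimately show ?thesis unfolding J_def
    by (smt (verit) exp_le_cancel_iff mult_minus_left)
qed

section \<open>Double edges and four-cycles in the configuration model\<close>

lemma finite_half_edges [simp]: "finite (half_edges ds)"
  by (simp add: half_edges_def)

lemma sum_entries_shift: "(\<Sum>i\<in>{1..length ds}. f (ds ! (i - 1))) = (\<Sum>i<length ds. f (ds ! i))"
  by (rule sum.reindex_bij_witness[of _ Suc "\<lambda>i. i - 1"]) auto

lemma card_half_edges: "card (half_edges ds) = sum_list ds"
  using sum_entries_shift[where f = "\<lambda>x. x" and ds = ds]
  by (simp add: half_edges_def sum_list_sum_nth lessThan_atLeast0)

lemma matchings_eq_bijections: "matchings d = bijections (half_edges (fst d)) (half_edges (snd d))"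
  by (simp add: matchings_def bijections_def)

definition twins :: "nat list \<Rightarrow> ((nat \<times> nat) \<times> (nat \<times> nat)) set" where
  "twins ds = {(h, h'). h \<in> half_edges ds \<and> h' \<in> half_edges ds \<and> fst h = fst h' \<and> h \<noteq> h'}"

lemma twins_subset: "twins ds \<subseteq> half_edges ds \<times> half_edges ds"
  and sym_twins: "sym (twins ds)" and irrefl_twins: "irrefl (twins ds)"
  by (auto simp: twins_def sym_def irrefl_def)

lemma card_twins_le: "card (twins ds) \<le> (\<Sum>i<length ds. (ds ! i) ^ 2)"
proof -
  let ?T = "SIGMA i:{1..length ds}. {1..ds ! (i - 1)} \<times> {1..ds ! (i - 1)}"
  have "twins ds \<subseteq> (\<lambda>(i, s, t). ((i, s), (i, t))) ` ?T"
    by (force simp: twins_def half_edges_def)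
  then have "card (twins ds) \<le> card ?T"
    by (meson card_image_le card_mono finite_imageI order_trans finite_SigmaI finite_atLeastAtMost finite_cartesian_product)
  also have "\<dots> = (\<Sum>i<length ds. (ds ! i) ^ 2)"
    using sum_entries_shift[where f = "\<lambda>x. x * x" and ds = ds]
    by (simp add: card_cartesian_product power2_eq_square)
  finally show ?thesis .
qed

lemma card_twins_Image_le: "(card (twins ds `` {h})) ^ 2 \<le> (\<Sum>i<length ds. (ds ! i) ^ 2)"
proof (cases "h \<in> half_edges ds")
  case True
  then obtain i s where h: "h = (i, s)" "1 \<le> i" "i \<le> length ds" by (auto simp: half_edges_def)
  have "twins ds `` {h} \<subseteq> {i} \<times> {1..ds ! (i - 1)}"
    using h by (auto simp: twins_def half_edges_def)
  then have "card (twins ds `` {h}) \<le> card ({i} \<times> {1..ds ! (i - 1)})"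
    by (intro card_mono) auto
  then have "(card (twins ds `` {h})) ^ 2 \<le> (ds ! (i - 1)) ^ 2"
    by (simp add: card_cartesian_product power_mono)
  also have "\<dots> \<le> (\<Sum>i<length ds. (ds ! i) ^ 2)"
    using h by (intro member_le_sum) auto
  finally show ?thesis .
next
  case False
  then have "twins ds `` {h} = {}" by (auto simp: twins_def)
  then show ?thesis by simp
qed

lemma edges_graph_of_matching:
  "edges (graph_of_matching d \<sigma>) = image_mset (\<lambda>h. (fst h, fst (\<sigma> h))) (mset_set (half_edges (fst d)))"
  by (simp add: graph_of_matching_def)

lemma simple_bmgraph_graph_of_matching_iff:
  "simple_bmgraph (graph_of_matching d \<sigma>) \<longleftrightarrow> inj_on (\<lambda>h. (fst h, fst (\<sigma> h))) (half_edges (fst d))"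
proof -
  let ?f = "\<lambda>h. (fst h, fst (\<sigma> h))" and ?H = "half_edges (fst d)"
  have cnt: "count (edges (graph_of_matching d \<sigma>)) e = card {h \<in> ?H. ?f h = e}" for e
  proof -
    have "count (edges (graph_of_matching d \<sigma>)) e = (\<Sum>x | x \<in># mset_set ?H \<and> e = ?f x. count (mset_set ?H) x)"
      unfolding edges_graph_of_matching by (rule count_image_mset')
    also have "\<dots> = (\<Sum>x | x \<in> ?H \<and> e = ?f x. 1)" by (intro sum.cong) auto
    also have "\<dots> = card {h \<in> ?H. ?f h = e}" by (simp add: eq_commute)
    finally show ?thesis .
  qed
  show ?thesis
  proof
    assume s: "simple_bmgraph (graph_of_matching d \<sigma>)"
    show "inj_on ?f ?H"
    proof (rule inj_onI)
      fix h h' assume h: "h \<in> ?H" "h' \<in> ?H" "?f h = ?f h'"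
      have "card {k \<in> ?H. ?f k = ?f h} \<le> 1"
        using s unfolding simple_bmgraph_def cnt[symmetric] by blast
      moreover have "h \<in> {k \<in> ?H. ?f k = ?f h}" "h' \<in> {k \<in> ?H. ?f k = ?f h}" using h by auto
      moreover have "finite {k \<in> ?H. ?f k = ?f h}" by simp
      ultimately show "h = h'"
        unfolding One_nat_def using card_le_Suc0_iff_eq[THEN iffD1] by blast
    qed
  next
    assume i: "inj_on ?f ?H"
    show "simple_bmgraph (graph_of_matching d \<sigma>)" unfolding simple_bmgraph_def cnt
    proof
      fix e
      have "inj_on ?f {h \<in> ?H. ?f h = e}" using i by (rule inj_on_subset) auto
      moreover have "?f ` {h \<in> ?H. ?f h = e} \<subseteq> {e}" by auto
      ultimately show "card {h \<in> ?H. ?f h = e} \<le> 1"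
        using card_inj_on_le[of ?f "{h \<in> ?H. ?f h = e}" "{e}"] by simp
    qed
  qed
qed

lemma nbrs_right_graph_of_matching:
  "nbrs_right (graph_of_matching d \<sigma>) a = fst ` {h \<in> half_edges (fst d). fst (\<sigma> h) = a}"
  by (force simp: nbrs_right_def edges_graph_of_matching)

text \<open>If two right-vertices \<open>a\<close> and \<open>b\<close> had the same neighbours, then the first two edges at \<open>a\<close> would
lead to two left-vertices (or form a double edge), both of which are also joined to \<open>b\<close>: this is a
four-cycle. The assumption that right-degrees are at least \<open>2\<close> cannot be dropped here, as groups
of size \<open>1\<close> may coincide without creating a cycle.\<close>

lemma graph_of_matching_good:
  assumes \<sigma>: "\<sigma> \<in> matchings d" and d2: "\<And>k. k \<in> set (snd d) \<Longrightarrow> 2 \<le> k"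
    and av: "\<sigma> \<in> avoiding extending
      (doubles (twins (fst d)) (twins (snd d)) \<union> squares (twins (fst d)) (twins (snd d)))"
  shows "simple_bmgraph (graph_of_matching d \<sigma>)" "distinct_groups (graph_of_matching d \<sigma>)"
proof -
  let ?H = "half_edges (fst d)" and ?H' = "half_edges (snd d)"
  have b: "bij_betw \<sigma> ?H ?H'" using \<sigma> by (simp add: matchings_def)
  have nodouble: "h = h'" if "h \<in> ?H" "h' \<in> ?H" "fst h = fst h'" "fst (\<sigma> h) = fst (\<sigma> h')" for h h'
  proof (rule ccontr)
    assume "h \<noteq> h'"
    then have "(h, h') \<in> twins (fst d)" "(\<sigma> h, \<sigma> h') \<in> twins (snd d)"
      using that b by (auto simp: twins_def bij_betw_def dest: inj_onD)
    then have "{(h, \<sigma> h), (h', \<sigma> h')} \<in> doubles (twins (fst d)) (twins (snd d))"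
      unfolding doubles_def by blast
    then have "\<sigma> \<notin> extending {(h, \<sigma> h), (h', \<sigma> h')}"
      using av unfolding avoiding_def by blast
    then show False by (simp add: extending_def)
  qed
  then show "simple_bmgraph (graph_of_matching d \<sigma>)"
    by (auto simp: simple_bmgraph_graph_of_matching_iff intro!: inj_onI)
  show "distinct_groups (graph_of_matching d \<sigma>)"
    unfolding distinct_groups_def
  proof (rule inj_onI, rule ccontr)
    let ?N = "nbrs_right (graph_of_matching d \<sigma>)"
    fix a b assume "a \<in> {1..nright (graph_of_matching d \<sigma>)}" and eq: "?N a = ?N b" and ab: "a \<noteq> b"
    then have a: "1 \<le> a" "a \<le> length (snd d)" by (auto simp: graph_of_matching_def)
    then have "2 \<le> snd d ! (a - 1)" by (intro d2) auto
    then have "(a, 1) \<in> ?H'" "(a, 2) \<in> ?H'" using a by (auto simp: half_edges_def)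
    then obtain x z where x: "x \<in> ?H" "\<sigma> x = (a, 1)" and z: "z \<in> ?H" "\<sigma> z = (a, 2)"
      using b unfolding bij_betw_def by (metis imageE)
    have "fst x \<in> ?N a" using x unfolding nbrs_right_graph_of_matching by force
    then obtain x' where x': "x' \<in> ?H" "fst (\<sigma> x') = b" "fst x' = fst x"
      unfolding eq unfolding nbrs_right_graph_of_matching by auto
    have "fst z \<in> ?N a" using z unfolding nbrs_right_graph_of_matching by force
    then obtain z' where z': "z' \<in> ?H" "fst (\<sigma> z') = b" "fst z' = fst z"
      unfolding eq unfolding nbrs_right_graph_of_matching by auto
    have "x \<noteq> z" using x z by auto
    then have xz: "fst x \<noteq> fst z" using nodouble[of x z] x z by auto
    have xx': "x \<noteq> x'" "z \<noteq> z'" using x z x' z' ab by auto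
    have dst: "distinct [x, x', z, z']" using xz xx' x' z' by auto
    have inj: "\<sigma> k = \<sigma> l \<longleftrightarrow> k = l" if "k \<in> ?H" "l \<in> ?H" for k l
      using b that by (auto simp: bij_betw_def dest: inj_onD)
    have dst': "distinct [\<sigma> x, \<sigma> z, \<sigma> x', \<sigma> z']"
      using dst inj x(1) z(1) x'(1) z'(1) by auto
    have mem: "\<sigma> k \<in> ?H'" if "k \<in> ?H" for k using b that by (auto dest: bij_betwE)
    have "(x, x') \<in> twins (fst d)" "(z, z') \<in> twins (fst d)"
      "(\<sigma> x, \<sigma> z) \<in> twins (snd d)" "(\<sigma> x', \<sigma> z') \<in> twins (snd d)"
      using x z x' z' dst dst' mem[of x] mem[of z] mem[of x'] mem[of z'] by (auto simp: twins_def)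
    then have "{(x, \<sigma> x), (x', \<sigma> x'), (z, \<sigma> z), (z', \<sigma> z')} \<in> squares (twins (fst d)) (twins (snd d))"
      using dst dst' by (rule squaresI) (rule refl)
    then have "\<sigma> \<notin> extending {(x, \<sigma> x), (x', \<sigma> x'), (z, \<sigma> z), (z', \<sigma> z')}"
      using av unfolding avoiding_def by blast
    then show False by (simp add: extending_def)
  qed
qed

section \<open>Graphs of lists of groups\<close>

lemma size_filter_mset_set: "finite A \<Longrightarrow> size (filter_mset P (mset_set A)) = card {x \<in> A. P x}"
  by (subst filter_mset_mset_set) auto

definition incidences :: "nat set list \<Rightarrow> (nat \<times> nat) set" where
  "incidences as = {(i, a). a \<in> {1..length as} \<and> i \<in> as ! (a - 1)}"

lemma graph_of_groups_sel [simp]: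
  "nleft (graph_of_groups n as) = n" "nright (graph_of_groups n as) = length as"
  "edges (graph_of_groups n as) = mset_set (incidences as)"
  by (simp_all add: graph_of_groups_def incidences_def)

lemma finite_groups [simp]: "finite (groups n)"
  by (rule finite_subset[of _ "Pow {1..n}"]) (auto simp: groups_def)

lemma incidences_subset:
  assumes "set as \<subseteq> groups n"
  shows "incidences as \<subseteq> {1..n} \<times> {1..length as}"
proof clarify
  fix i a assume "(i, a) \<in> incidences as"
  then have a: "a \<in> {1..length as}" and i: "i \<in> as ! (a - 1)" by (auto simp: incidences_def)
  from a have "as ! (a - 1) \<in> set as" by (intro nth_mem) auto
  then have "as ! (a - 1) \<subseteq> {1..n}" using assms by (auto simp: groups_def)
  then show "i \<in> {1..n} \<and> a \<in> {1..length as}" using i a by auto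
qed

lemma finite_incidences: "set as \<subseteq> groups n \<Longrightarrow> finite (incidences as)"
  by (rule finite_subset[OF incidences_subset]) auto

lemma nbrs_right_graph_of_groups:
  assumes "set as \<subseteq> groups n" "a \<in> {1..length as}"
  shows "nbrs_right (graph_of_groups n as) a = as ! (a - 1)"
  using finite_incidences[OF assms(1)] assms(2) by (auto simp: nbrs_right_def incidences_def)

text \<open>Recovers the list of groups from the graph; so \<open>graph_of_groups n\<close> is injective on
lists of groups of \<open>{1..n}\<close>, and the law of the graph can be read off from that of the list.\<close>

definition groups_of :: "bmgraph \<Rightarrow> nat set list" where
  "groups_of G = map (nbrs_right G) [1..<Suc (nright G)]"

lemma groups_of_graph_of_groups:
  assumes "set as \<subseteq> groups n"
  shows "groups_of (graph_of_groups n as) = as"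
  by (rule nth_equalityI) (auto simp: groups_of_def nbrs_right_graph_of_groups[OF assms] simp del: upt_Suc)

lemma simple_graph_of_groups: "simple_bmgraph (graph_of_groups n as)"
  by (simp add: simple_bmgraph_def count_mset_set')

lemma distinct_groups_graph_of_groups:
  assumes "set as \<subseteq> groups n" "distinct as"
  shows "distinct_groups (graph_of_groups n as)"
  unfolding distinct_groups_def
proof (rule inj_onI)
  fix a b assume ab: "a \<in> {1..nright (graph_of_groups n as)}" "b \<in> {1..nright (graph_of_groups n as)}"
    and "nbrs_right (graph_of_groups n as) a = nbrs_right (graph_of_groups n as) b"
  then have "as ! (a - 1) = as ! (b - 1)" by (simp add: nbrs_right_graph_of_groups[OF assms(1)])
  moreover have "a - 1 < length as" "b - 1 < length as" using ab by auto
  ultimately have "a - 1 = b - 1" using assms(2) by (simp add: nth_eq_iff_index_eq)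
  then show "a = b" using ab by auto
qed

lemma deg_right_graph_of_groups:
  assumes "set as \<subseteq> groups n" "a \<in> {1..length as}"
  shows "deg_right (graph_of_groups n as) a = card (as ! (a - 1))"
proof -
  have "{e \<in> incidences as. snd e = a} = (\<lambda>i. (i, a)) ` (as ! (a - 1))"
    using assms(2) by (auto simp: incidences_def)
  then show ?thesis
    by (simp add: deg_right_def size_filter_mset_set finite_incidences[OF assms(1)] card_image inj_on_def)
qed

lemma deg_left_graph_of_groups:
  assumes "set as \<subseteq> groups n"
  shows "deg_left (graph_of_groups n as) i = card {k. k < length as \<and> i \<in> as ! k}"
proof -
  have "{e \<in> incidences as. fst e = i} = (\<lambda>k. (i, Suc k)) ` {k. k < length as \<and> i \<in> as ! k}"
  proof (intro equalityI subsetI)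
    fix e assume "e \<in> {e \<in> incidences as. fst e = i}"
    then show "e \<in> (\<lambda>k. (i, Suc k)) ` {k. k < length as \<and> i \<in> as ! k}"
      by (intro image_eqI[of _ _ "snd e - 1"]) (auto simp: incidences_def)
  qed (auto simp: incidences_def)
  then show ?thesis
    by (simp add: deg_left_def size_filter_mset_set finite_incidences[OF assms(1)] card_image inj_on_def)
qed

lemma degree_sequence_graph_of_groups:
  assumes "set as \<subseteq> groups n"
  shows "degree_sequence (graph_of_groups n as) =
    (map (\<lambda>i. card {k. k < length as \<and> i \<in> as ! k}) [1..<Suc n], map card as)"
  by (auto simp: degree_sequence_def deg_left_graph_of_groups[OF assms]
      deg_right_graph_of_groups[OF assms] simp del: upt_Suc intro!: nth_equalityI)

text \<open>The odds \<open>P / (1 - P)\<close> of the event that the group is ON.\<close>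

definition odds :: "nat pmf \<Rightarrow> nat \<Rightarrow> (nat \<Rightarrow> real) \<Rightarrow> nat set \<Rightarrow> real" where
  "odds p n w a = size_factor p (card a) / total_weight n w ^ (card a - 1) * (\<Prod>i\<in>a. w i)"

lemma pmf_on_groups:
  assumes w: "\<And>i. i \<in> {1..n} \<Longrightarrow> w i \<ge> 0" and l: "total_weight n w > 0" and A: "A \<subseteq> groups n"
  shows "pmf (on_groups p n w) A = (\<Prod>a\<in>A. odds p n w a) * (\<Prod>a\<in>groups n. 1 / (1 + odds p n w a))"
proof -
  let ?M = "Pi_pmf (groups n) False (\<lambda>a. bernoulli_pmf (on_prob p n w a))"
  have odds0: "0 \<le> odds p n w a" if "a \<in> groups n" for a
  proof -
    have "a \<subseteq> {1..n}" using that by (simp add: groups_def)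
    then have "0 \<le> (\<Prod>i\<in>a. w i)" by (intro prod_nonneg w) auto
    then show ?thesis using l by (simp add: odds_def size_factor_def)
  qed
  have on: "on_prob p n w a = odds p n w a / (1 + odds p n w a)" for a
  proof -
    have "on_prob p n w a = (size_factor p (card a) * (\<Prod>i\<in>a. w i)) /
      (total_weight n w ^ (card a - 1) * (1 + odds p n w a))"
      unfolding on_prob_def odds_def using l by (simp add: distrib_left)
    also have "\<dots> = odds p n w a / (1 + odds p n w a)" by (simp add: odds_def)
    finally show ?thesis .
  qed
  have "pmf (on_groups p n w) A = measure_pmf.prob ?M {s. {a \<in> groups n. s a} = A}"
    by (simp add: on_groups_def pmf_map vimage_def)
  also have "\<dots> = measure_pmf.prob ?M {\<lambda>a. a \<in> A}"
  proof (rule measure_prob_cong_0)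
    fix s assume s: "s \<in> {s. {a \<in> groups n. s a} = A} - {\<lambda>a. a \<in> A}"
    then have "\<exists>a. a \<notin> groups n \<and> s a \<noteq> False" by auto
    then show "pmf ?M s = 0" by (intro pmf_Pi_outside) auto
  qed (use A in auto)
  also have "\<dots> = (\<Prod>a\<in>groups n. pmf (bernoulli_pmf (on_prob p n w a)) (a \<in> A))"
    unfolding measure_pmf_single by (rule pmf_Pi') (use A in auto)
  also have "\<dots> = (\<Prod>a\<in>groups n. (if a \<in> A then odds p n w a else 1) * (1 / (1 + odds p n w a)))"
  proof (intro prod.cong refl)
    fix a assume a: "a \<in> groups n"
    note o = odds0[OF a]
    have r: "0 \<le> on_prob p n w a" "on_prob p n w a \<le> 1" using o unfolding on by simp_all
    show "pmf (bernoulli_pmf (on_prob p n w a)) (a \<in> A) =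
        (if a \<in> A then odds p n w a else 1) * (1 / (1 + odds p n w a))"
    proof (cases "a \<in> A")
      case True
      then show ?thesis using r by (simp add: on)
    next
      case False
      then have "pmf (bernoulli_pmf (on_prob p n w a)) (a \<in> A) = 1 - on_prob p n w a" using r by simp
      then show ?thesis using False o by (simp add: on field_simps)
    qed
  qed
  also have "\<dots> = (\<Prod>a\<in>groups n. if a \<in> A then odds p n w a else 1) * (\<Prod>a\<in>groups n. 1 / (1 + odds p n w a))"
    by (rule prod.distrib)
  also have "(\<Prod>a\<in>groups n. if a \<in> A then odds p n w a else 1) = (\<Prod>a\<in>A. odds p n w a)"
    using A by (simp add: prod.If_cases Int_absorb1)
  finally show ?thesis .
qed

lemma set_on_groups: "A \<in> set_pmf (on_groups p n w) \<Longrightarrow> A \<subseteq> groups n"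
  by (auto simp: on_groups_def)

definition labelled_groups :: "nat pmf \<Rightarrow> nat \<Rightarrow> (nat \<Rightarrow> real) \<Rightarrow> nat set list pmf" where
  "labelled_groups p n w = bind_pmf (on_groups p n w) (\<lambda>A. pmf_of_set (permutations_of_set A))"

lemma BGRG_eq: "BGRG p n w = map_pmf (graph_of_groups n) (labelled_groups p n w)"
  by (simp add: BGRG_def labelled_groups_def map_bind_pmf)

lemma set_labelled_groups: "as \<in> set_pmf (labelled_groups p n w) \<Longrightarrow> distinct as \<and> set as \<subseteq> groups n"
proof -
  assume "as \<in> set_pmf (labelled_groups p n w)"
  then obtain A where A: "A \<in> set_pmf (on_groups p n w)" "as \<in> set_pmf (pmf_of_set (permutations_of_set A))"
    by (auto simp: labelled_groups_def)
  have "finite A" using set_on_groups[OF A(1)] by (rule finite_subset) simp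
  then have "as \<in> permutations_of_set A" using A(2) by (subst (asm) set_pmf_of_set) auto
  then show ?thesis using set_on_groups[OF A(1)] by (auto simp: permutations_of_set_def)
qed

lemma pmf_labelled_groups:
  assumes "distinct as" "set as \<subseteq> groups n"
  shows "pmf (labelled_groups p n w) as = pmf (on_groups p n w) (set as) / fact (length as)"
proof -
  have "pmf (labelled_groups p n w) as =
      measure_pmf.expectation (on_groups p n w) (\<lambda>A. pmf (pmf_of_set (permutations_of_set A)) as)"
    by (simp add: labelled_groups_def pmf_bind)
  also have "\<dots> = measure_pmf.expectation (on_groups p n w) (\<lambda>A. indicator {set as} A / fact (length as))"
  proof (intro integral_cong_AE AE_pmfI)
    fix A assume "A \<in> set_pmf (on_groups p n w)"
    then have A: "finite A" by (rule finite_subset[OF set_on_groups finite_groups])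
    have "pmf (pmf_of_set (permutations_of_set A)) as = indicator (permutations_of_set A) as / fact (card A)"
      using A by (subst pmf_of_set) auto
    then show "pmf (pmf_of_set (permutations_of_set A)) as = indicator {set as} A / fact (length as)"
      using assms(1) distinct_card[OF assms(1)]
      by (simp add: indicator_def permutations_of_set_def)
  qed auto
  also have "\<dots> = pmf (on_groups p n w) (set as) / fact (length as)"
    by (simp add: measure_pmf_single)
  finally show ?thesis .
qed

text \<open>The possible values of the generalized random graph, irrespective of their probabilities.\<close>

definition group_graphs :: "nat \<Rightarrow> bmgraph set" where
  "group_graphs n = graph_of_groups n ` {as. distinct as \<and> set as \<subseteq> groups n}"

lemma set_BGRG: "set_pmf (BGRG p n w) \<subseteq> group_graphs n"
  using set_labelled_groups by (auto simp: BGRG_eq group_graphs_def)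

text \<open>The common probability of all graphs in \<open>group_graphs n\<close> with degree sequence \<open>d\<close>. The last
factor accounts for the random labelling of the groups.\<close>

definition degree_weight :: "nat pmf \<Rightarrow> nat \<Rightarrow> (nat \<Rightarrow> real) \<Rightarrow> degree_seq \<Rightarrow> real" where
  "degree_weight p n w d =
     (\<Prod>k\<leftarrow>snd d. size_factor p k / total_weight n w ^ (k - 1)) * (\<Prod>i\<in>{1..n}. w i ^ (fst d ! (i - 1)))
       * (\<Prod>a\<in>groups n. 1 / (1 + odds p n w a)) / fact (length (snd d))"

lemma pmf_BGRG:
  assumes w: "\<And>i. i \<in> {1..n} \<Longrightarrow> w i \<ge> 0" and l: "total_weight n w > 0" and G: "G \<in> group_graphs n"
  shows "pmf (BGRG p n w) G = degree_weight p n w (degree_sequence G)"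
proof -
  obtain as where as: "distinct as" "set as \<subseteq> groups n" and G: "G = graph_of_groups n as"
    using G by (auto simp: group_graphs_def)
  have sub: "a \<subseteq> {1..n}" if "a \<in> set as" for a using that as(2) by (auto simp: groups_def)
  have "pmf (BGRG p n w) G = measure_pmf.prob (labelled_groups p n w) (graph_of_groups n -` {G})"
    by (simp add: BGRG_eq pmf_map)
  also have "\<dots> = measure_pmf.prob (labelled_groups p n w) {as}"
  proof (rule measure_prob_cong_0)
    fix bs assume bs: "bs \<in> graph_of_groups n -` {G} - {as}"
    show "pmf (labelled_groups p n w) bs = 0"
    proof (rule ccontr)
      assume "pmf (labelled_groups p n w) bs \<noteq> 0"
      then have "set bs \<subseteq> groups n" using set_labelled_groups[of bs p n w] by (simp add: set_pmf_iff)
      then have "bs = as" using bs as(2) G groups_of_graph_of_groups by (metis DiffD1 singletonD vimageE)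
      then show False using bs by simp
    qed
  qed (simp add: G)
  also have "\<dots> = pmf (on_groups p n w) (set as) / fact (length as)"
    by (simp add: measure_pmf_single pmf_labelled_groups[OF as])
  also have "pmf (on_groups p n w) (set as) =
      (\<Prod>a\<in>set as. odds p n w a) * (\<Prod>a\<in>groups n. 1 / (1 + odds p n w a))"
    by (rule pmf_on_groups[OF w l as(2)])
  also have "(\<Prod>a\<in>set as. odds p n w a) =
      (\<Prod>a\<in>set as. size_factor p (card a) / total_weight n w ^ (card a - 1)) * (\<Prod>a\<in>set as. \<Prod>i\<in>a. w i)"
    by (simp add: odds_def flip: prod.distrib)
  also have "(\<Prod>a\<in>set as. size_factor p (card a) / total_weight n w ^ (card a - 1)) =
      (\<Prod>k\<leftarrow>map card as. size_factor p k / total_weight n w ^ (k - 1))"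
    using as(1) by (simp add: prod.distinct_set_conv_list o_def)
  also have "(\<Prod>a\<in>set as. \<Prod>i\<in>a. w i) = (\<Prod>a\<in>set as. \<Prod>i\<in>{i \<in> {1..n}. i \<in> a}. w i)"
  proof (rule prod.cong[OF refl])
    fix a assume "a \<in> set as"
    from sub[OF this] have "{i \<in> {1..n}. i \<in> a} = a" by auto
    then show "(\<Prod>i\<in>a. w i) = (\<Prod>i\<in>{i \<in> {1..n}. i \<in> a}. w i)" by simp
  qed
  also have "\<dots> = (\<Prod>a\<in>set as. \<Prod>i\<in>{1..n}. if i \<in> a then w i else 1)"
    by (rule prod.cong[OF refl], rule prod.inter_filter) simp
  also have "\<dots> = (\<Prod>i\<in>{1..n}. \<Prod>a\<in>set as. if i \<in> a then w i else 1)"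
    by (rule prod.swap)
  also have "\<dots> = (\<Prod>i\<in>{1..n}. w i ^ card {k. k < length as \<and> i \<in> as ! k})"
  proof (intro prod.cong refl)
    fix i
    have "(\<Prod>a\<in>set as. if i \<in> a then w i else 1) = w i ^ card {a \<in> set as. i \<in> a}"
      by (simp add: prod.If_cases Int_def)
    also have "{a \<in> set as. i \<in> a} = (!) as ` {k. k < length as \<and> i \<in> as ! k}"
      by (auto simp: in_set_conv_nth)
    also have "card \<dots> = card {k. k < length as \<and> i \<in> as ! k}"
      using as(1) by (intro card_image) (auto simp: inj_on_def nth_eq_iff_index_eq)
    finally show "(\<Prod>a\<in>set as. if i \<in> a then w i else 1) = w i ^ card {k. k < length as \<and> i \<in> as ! k}" .
  qed
  also have "\<dots> = (\<Prod>i\<in>{1..n}. w i ^ (fst (degree_sequence G) ! (i - 1)))"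
  proof (rule prod.cong[OF refl])
    fix i assume i: "i \<in> {1..n}"
    then have "[1..<Suc n] ! (i - 1) = i" by (subst nth_upt) auto
    moreover have "fst (degree_sequence G) ! (i - 1) = card {k. k < length as \<and> [1..<Suc n] ! (i - 1) \<in> as ! k}"
      unfolding G degree_sequence_graph_of_groups[OF as(2)] fst_conv
      by (rule nth_map) (use i in auto)
    ultimately show "w i ^ card {k. k < length as \<and> i \<in> as ! k} = w i ^ (fst (degree_sequence G) ! (i - 1))"
      by simp
  qed
  finally show ?thesis
    by (simp add: degree_weight_def G degree_sequence_graph_of_groups[OF as(2)] mult_ac del: upt_Suc)
qed

lemma simple_bmgraph_edges:
  assumes "simple_bmgraph G"
  shows "edges G = mset_set (set_mset (edges G))"
proof (rule multiset_eqI)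
  fix e
  show "count (edges G) e = count (mset_set (set_mset (edges G))) e"
    using assms[unfolded simple_bmgraph_def, rule_format, of e]
    by (auto simp: count_mset_set' count_eq_zero_iff le_Suc_eq)
qed

text \<open>Conversely to \<open>simple_graph_of_groups\<close> and \<open>distinct_groups_graph_of_groups\<close>, these
properties characterize the graphs that the generalized random graph can produce.\<close>

lemma in_group_graphsI:
  assumes s: "simple_bmgraph G" and dg: "distinct_groups G"
    and E: "set_mset (edges G) \<subseteq> {1..nleft G} \<times> {1..nright G}"
    and d2: "\<And>k. k \<in> set (snd (degree_sequence G)) \<Longrightarrow> 2 \<le> k"
  shows "G \<in> group_graphs (nleft G)"
proof -
  have N: "nbrs_right G a \<in> groups (nleft G)" if "a \<in> {1..nright G}" for a
  proof -
    have "{e \<in> set_mset (edges G). snd e = a} = (\<lambda>i. (i, a)) ` nbrs_right G a"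
      by (auto simp: nbrs_right_def)
    moreover have "deg_right G a = card {e \<in> set_mset (edges G). snd e = a}"
      unfolding deg_right_def by (subst simple_bmgraph_edges[OF s]) (simp add: size_filter_mset_set)
    ultimately have "deg_right G a = card (nbrs_right G a)"
      by (simp add: card_image inj_on_def)
    moreover have "2 \<le> deg_right G a"
      using that by (intro d2) (auto simp: degree_sequence_def simp del: upt_Suc)
    moreover have "nbrs_right G a \<subseteq> {1..nleft G}" using E by (auto simp: nbrs_right_def)
    ultimately show ?thesis by (simp add: groups_def)
  qed
  have "incidences (groups_of G) = set_mset (edges G)"
    using E by (fastforce simp: incidences_def groups_of_def nbrs_right_def simp del: upt_Suc)
  then have "G = graph_of_groups (nleft G) (groups_of G)"
    using simple_bmgraph_edges[OF s] by (intro bmgraph.expand) (simp add: groups_of_def)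
  moreover have "set (groups_of G) \<subseteq> groups (nleft G)"
    using N by (auto simp: groups_of_def simp del: upt_Suc)
  moreover have "distinct (groups_of G)"
    using dg by (simp add: groups_of_def distinct_map distinct_groups_def atLeastLessThanSuc_atLeastAtMost del: upt_Suc)
  ultimately show ?thesis by (auto simp: group_graphs_def)
qed

section \<open>Matchings that produce a given graph\<close>

lemma ex_fibrewise_bij:
  assumes "finite S" "finite E" and card: "\<And>i. card {h \<in> S. f h = i} = card {e \<in> E. g e = i}"
  obtains \<alpha> where "bij_betw \<alpha> S E" "\<And>h. h \<in> S \<Longrightarrow> g (\<alpha> h) = f h"
proof -
  have "\<exists>F. bij_betw F {h \<in> S. f h = i} {e \<in> E. g e = i}" for i
    using assms by (intro finite_same_card_bij) auto
  then obtain F where F: "\<And>i. bij_betw (F i) {h \<in> S. f h = i} {e \<in> E. g e = i}" by metis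
  define \<alpha> where "\<alpha> h = F (f h) h" for h
  have mem: "\<alpha> h \<in> E \<and> g (\<alpha> h) = f h" if "h \<in> S" for h
    using bij_betwE[OF F[of "f h"]] that by (auto simp: \<alpha>_def)
  have "inj_on \<alpha> S"
  proof (rule inj_onI)
    fix h h' assume h: "h \<in> S" "h' \<in> S" "\<alpha> h = \<alpha> h'"
    then have "f h = f h'" using mem by metis
    then show "h = h'" using h inj_onD[OF bij_betw_imp_inj_on[OF F[of "f h"]], of h h'] by (simp add: \<alpha>_def)
  qed
  moreover have "\<alpha> ` S = E"
  proof (intro equalityI subsetI)
    fix e assume "e \<in> E"
    then have "e \<in> F (g e) ` {h \<in> S. f h = g e}" using bij_betw_imp_surj_on[OF F[of "g e"]] by auto
    then obtain h where "h \<in> S" "f h = g e" "e = F (g e) h" by auto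
    then have "h \<in> S" "e = \<alpha> h" by (simp_all add: \<alpha>_def)
    then show "e \<in> \<alpha> ` S" by blast
  qed (use mem in auto)
  ultimately show ?thesis using mem by (intro that[of \<alpha>]) (auto simp: bij_betw_def)
qed

lemma card_half_edges_at:
  assumes "i \<in> {1..length ds}"
  shows "card {h \<in> half_edges ds. fst h = i} = ds ! (i - 1)"
proof -
  have "{h \<in> half_edges ds. fst h = i} = {i} \<times> {1..ds ! (i - 1)}"
    using assms by (auto simp: half_edges_def)
  then show ?thesis by (simp add: card_cartesian_product)
qed

lemma degree_sequence_graph_of_matching:
  assumes \<sigma>: "\<sigma> \<in> matchings d"
  shows "degree_sequence (graph_of_matching d \<sigma>) = d"
proof -
  let ?G = "graph_of_matching d \<sigma>" and ?H = "half_edges (fst d)" and ?H' = "half_edges (snd d)"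
  have b: "bij_betw \<sigma> ?H ?H'" using \<sigma> by (simp add: matchings_def)
  have "deg_left ?G i = fst d ! (i - 1)" if "i \<in> {1..length (fst d)}" for i
    using card_half_edges_at[OF that]
    by (simp add: deg_left_def edges_graph_of_matching filter_mset_image_mset o_def size_filter_mset_set)
  moreover have "deg_right ?G a = snd d ! (a - 1)" if "a \<in> {1..length (snd d)}" for a
  proof -
    have T: "?H' = \<sigma> ` ?H" using b by (simp add: bij_betw_def)
    have "\<sigma> ` {h \<in> ?H. fst (\<sigma> h) = a} = {h \<in> ?H'. fst h = a}" unfolding T by auto
    moreover have "inj_on \<sigma> {h \<in> ?H. fst (\<sigma> h) = a}"
      using b by (auto simp: bij_betw_def intro: inj_on_subset)
    ultimately have "card {h \<in> ?H. fst (\<sigma> h) = a} = card {h \<in> ?H'. fst h = a}"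
      using card_image[of \<sigma> "{h \<in> ?H. fst (\<sigma> h) = a}"] by (simp only:)
    then show ?thesis using card_half_edges_at[OF that]
      by (simp add: deg_right_def edges_graph_of_matching filter_mset_image_mset o_def size_filter_mset_set)
  qed
  moreover have "nleft ?G = length (fst d)" "nright ?G = length (snd d)"
    by (simp_all add: graph_of_matching_def)
  ultimately have "fst (degree_sequence ?G) = fst d" "snd (degree_sequence ?G) = snd d"
    by (intro nth_equalityI; simp add: degree_sequence_def del: upt_Suc)+
  then show ?thesis by (rule prod_eqI)
qed

lemma edges_in_range_graph_of_matching:
  assumes \<sigma>: "\<sigma> \<in> matchings d"
  shows "set_mset (edges (graph_of_matching d \<sigma>)) \<subseteq> {1..length (fst d)} \<times> {1..length (snd d)}"
proof -
  have "\<sigma> h \<in> half_edges (snd d)" if "h \<in> half_edges (fst d)" for h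
    using \<sigma> that by (auto simp: matchings_def)
  then show ?thesis by (force simp: edges_graph_of_matching half_edges_def)
qed

text \<open>Counted with the degrees, the half-edges on either side are in bijection with the edges, by a
bijection respecting the endpoint on that side. Going from left half-edges to edges and back to right
half-edges is the required matching.\<close>

lemma ex_matching_of_graph:
  assumes s: "simple_bmgraph G" and E: "set_mset (edges G) \<subseteq> {1..nleft G} \<times> {1..nright G}"
    and d: "degree_sequence G = d"
  obtains \<sigma> where "\<sigma> \<in> matchings d" "graph_of_matching d \<sigma> = G"
proof -
  let ?E = "set_mset (edges G)" and ?H = "half_edges (fst d)" and ?H' = "half_edges (snd d)"
  have len: "length (fst d) = nleft G" "length (snd d) = nright G"
    using d by (auto simp: degree_sequence_def)
  have nth: "fst d ! (i - 1) = deg_left G i" if "i \<in> {1..nleft G}" for i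
    using that d by (auto simp: degree_sequence_def simp del: upt_Suc)
  have nth': "snd d ! (a - 1) = deg_right G a" if "a \<in> {1..nright G}" for a
    using that d by (auto simp: degree_sequence_def simp del: upt_Suc)
  have dl: "deg_left G i = card {e \<in> ?E. fst e = i}" for i
    unfolding deg_left_def by (subst simple_bmgraph_edges[OF s]) (simp add: size_filter_mset_set)
  have dr: "deg_right G a = card {e \<in> ?E. snd e = a}" for a
    unfolding deg_right_def by (subst simple_bmgraph_edges[OF s]) (simp add: size_filter_mset_set)
  have 1: "card {h \<in> ?H. fst h = i} = card {e \<in> ?E. fst e = i}" for i
  proof (cases "i \<in> {1..nleft G}")
    case True
    then show ?thesis using card_half_edges_at[of i "fst d"] nth[OF True] dl[of i] len by simp
  next
    case False
    then have "{h \<in> ?H. fst h = i} = {}" "{e \<in> ?E. fst e = i} = {}"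
      using E len by (auto simp: half_edges_def)
    then show ?thesis by (simp only:)
  qed
  have 2: "card {h \<in> ?H'. fst h = a} = card {e \<in> ?E. snd e = a}" for a
  proof (cases "a \<in> {1..nright G}")
    case True
    then show ?thesis using card_half_edges_at[of a "snd d"] nth'[OF True] dr[of a] len by simp
  next
    case False
    then have "{h \<in> ?H'. fst h = a} = {}" "{e \<in> ?E. snd e = a} = {}"
      using E len by (auto simp: half_edges_def)
    then show ?thesis by (simp only:)
  qed
  obtain \<alpha> where \<alpha>: "bij_betw \<alpha> ?H ?E" "\<And>h. h \<in> ?H \<Longrightarrow> fst (\<alpha> h) = fst h"
    using ex_fibrewise_bij[of ?H ?E fst fst] 1 by auto
  obtain \<beta> where \<beta>: "bij_betw \<beta> ?H' ?E" "\<And>h. h \<in> ?H' \<Longrightarrow> snd (\<beta> h) = fst h"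
    using ex_fibrewise_bij[of ?H' ?E fst snd] 2 by auto
  define \<sigma> where "\<sigma> = restrict (inv_into ?H' \<beta> \<circ> \<alpha>) ?H"
  have "bij_betw (inv_into ?H' \<beta> \<circ> \<alpha>) ?H ?H'"
    using \<alpha>(1) bij_betw_inv_into[OF \<beta>(1)] by (rule bij_betw_trans)
  then have b: "bij_betw \<sigma> ?H ?H'" by (simp add: \<sigma>_def bij_betw_restrict_eq)
  then have \<sigma>: "\<sigma> \<in> matchings d"
    by (auto simp: matchings_def \<sigma>_def dest: bij_betwE)
  have "(fst h, fst (\<sigma> h)) = \<alpha> h" if h: "h \<in> ?H" for h
  proof -
    have "\<beta> (\<sigma> h) = \<alpha> h"
      using h bij_betwE[OF \<alpha>(1)] bij_betw_inv_into_right[OF \<beta>(1)] by (simp add: \<sigma>_def)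
    moreover have "\<sigma> h \<in> ?H'" using b h by (auto dest: bij_betwE)
    ultimately have "fst (\<sigma> h) = snd (\<alpha> h)" using \<beta>(2)[of "\<sigma> h"] by simp
    then show ?thesis using \<alpha>(2)[OF h] by (simp add: prod_eq_iff)
  qed
  then have "edges (graph_of_matching d \<sigma>) = image_mset \<alpha> (mset_set ?H)"
    unfolding edges_graph_of_matching by (intro image_mset_cong) auto
  also have "\<dots> = mset_set ?E"
    using \<alpha>(1) by (simp add: image_mset_mset_set bij_betw_def)
  also have "\<dots> = edges G" by (rule simple_bmgraph_edges[OF s, symmetric])
  finally have "graph_of_matching d \<sigma> = G"
    using len by (intro bmgraph.expand) (simp add: graph_of_matching_def)
  with \<sigma> show ?thesis by (rule that)
qed

definition relabellings :: "nat list \<Rightarrow> (nat \<times> nat \<Rightarrow> nat \<times> nat) set" where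
  "relabellings ds = {\<pi>. \<pi> permutes half_edges ds \<and> (\<forall>h. fst (\<pi> h) = fst h)}"

text \<open>The group of pairs of relabellings acts on the matchings that produce the given graph, and this
action is simply transitive. Each edge \<open>(i, a)\<close> of a simple graph belongs to exactly one left
half-edge in each matching. So two matchings \<open>\<sigma>0\<close> and \<open>\<sigma>\<close> determine a relabelling \<open>\<pi>\<close> on the left,
sending the half-edge used by \<open>\<sigma>\<close> for an edge to the one used by \<open>\<sigma>0\<close>, and then \<open>\<rho>\<close> is forced by
\<open>\<sigma> = \<rho> \<circ> \<sigma>0 \<circ> \<pi>\<close>.\<close>

lemma card_matchings_of_simple_graph:
  assumes \<sigma>0: "\<sigma>0 \<in> matchings d" and s: "simple_bmgraph (graph_of_matching d \<sigma>0)"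
  shows "card {\<sigma> \<in> matchings d. graph_of_matching d \<sigma> = graph_of_matching d \<sigma>0}
    = card (relabellings (fst d)) * card (relabellings (snd d))"
proof -
  let ?S = "half_edges (fst d)" and ?T = "half_edges (snd d)"
  let ?X = "{\<sigma> \<in> matchings d. graph_of_matching d \<sigma> = graph_of_matching d \<sigma>0}"
  define f where "f \<sigma> h = (fst h, fst (\<sigma> h))" for \<sigma> :: "nat \<times> nat \<Rightarrow> nat \<times> nat" and h :: "nat \<times> nat"
  have ed: "edges (graph_of_matching d \<sigma>) = image_mset (f \<sigma>) (mset_set ?S)" for \<sigma>
    unfolding edges_graph_of_matching f_def ..
  have inj: "inj_on (f \<sigma>) ?S" if "\<sigma> \<in> ?X" for \<sigma>
    using s that simple_bmgraph_graph_of_matching_iff[of d \<sigma>] by (auto simp: f_def[abs_def])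
  have img: "f \<sigma> ` ?S = f \<sigma>0 ` ?S" if "\<sigma> \<in> ?X" for \<sigma>
  proof -
    have "edges (graph_of_matching d \<sigma>) = edges (graph_of_matching d \<sigma>0)" using that by simp
    then have "set_mset (image_mset (f \<sigma>) (mset_set ?S)) = set_mset (image_mset (f \<sigma>0) (mset_set ?S))"
      unfolding ed by simp
    then show ?thesis by simp
  qed
  have \<sigma>0X: "\<sigma>0 \<in> ?X" using \<sigma>0 by simp
  have b: "bij_betw \<sigma> ?S ?T" if "\<sigma> \<in> ?X" for \<sigma> using that by (simp add: matchings_def)
  note b0 = b[OF \<sigma>0X] and inj0 = inj[OF \<sigma>0X]
  define \<Phi> where "\<Phi> = (\<lambda>(\<pi>, \<rho> :: nat \<times> nat \<Rightarrow> nat \<times> nat). restrict (\<rho> \<circ> \<sigma>0 \<circ> \<pi>) ?S)"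
  have rel: "bij_betw \<pi> (half_edges ds) (half_edges ds)" "\<And>h. fst (\<pi> h) = fst h"
    if "\<pi> \<in> relabellings ds" for \<pi> ds
    using that by (auto simp: relabellings_def permutes_imp_bij)
  have "bij_betw \<Phi> (relabellings (fst d) \<times> relabellings (snd d)) ?X"
  proof (rule bij_betw_imageI)
    show "inj_on \<Phi> (relabellings (fst d) \<times> relabellings (snd d))"
    proof (rule inj_onI, clarify)
      fix \<pi> \<rho> \<pi>' \<rho>'
      assume \<pi>: "\<pi> \<in> relabellings (fst d)" and \<rho>: "\<rho> \<in> relabellings (snd d)"
        and \<pi>': "\<pi>' \<in> relabellings (fst d)" and \<rho>': "\<rho>' \<in> relabellings (snd d)"
        and eq: "\<Phi> (\<pi>, \<rho>) = \<Phi> (\<pi>', \<rho>')"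
      have eqh: "\<rho> (\<sigma>0 (\<pi> h)) = \<rho>' (\<sigma>0 (\<pi>' h))" if "h \<in> ?S" for h
        using fun_cong[OF eq, of h] that by (simp add: \<Phi>_def)
      have "\<pi> h = \<pi>' h" for h
      proof (cases "h \<in> ?S")
        case True
        have "fst (\<sigma>0 (\<pi> h)) = fst (\<sigma>0 (\<pi>' h))"
          using eqh[OF True] rel(2)[OF \<rho>] rel(2)[OF \<rho>'] by metis
        then have "f \<sigma>0 (\<pi> h) = f \<sigma>0 (\<pi>' h)" by (simp add: f_def rel(2)[OF \<pi>] rel(2)[OF \<pi>'])
        moreover have "\<pi> h \<in> ?S" "\<pi>' h \<in> ?S"
          using True rel(1)[OF \<pi>] rel(1)[OF \<pi>'] by (auto dest: bij_betwE)
        ultimately show ?thesis using inj0 by (auto dest: inj_onD)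
      next
        case False
        have "\<pi> permutes ?S" "\<pi>' permutes ?S" using \<pi> \<pi>' by (simp_all add: relabellings_def)
        then show ?thesis using False by (metis permutes_not_in)
      qed
      then have 1: "\<pi> = \<pi>'" by auto
      have "\<rho> t = \<rho>' t" for t
      proof (cases "t \<in> ?T")
        case True
        have "bij_betw (\<sigma>0 \<circ> \<pi>) ?S ?T" using rel(1)[OF \<pi>] b0 by (rule bij_betw_trans)
        then have "t \<in> (\<sigma>0 \<circ> \<pi>) ` ?S" using True by (simp only: bij_betw_def)
        then obtain h where "h \<in> ?S" "t = \<sigma>0 (\<pi> h)" by auto
        then show ?thesis using eqh 1 by simp
      next
        case False
        have "\<rho> permutes ?T" "\<rho>' permutes ?T" using \<rho> \<rho>' by (simp_all add: relabellings_def)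
        then show ?thesis using False by (metis permutes_not_in)
      qed
      then show "\<pi> = \<pi>' \<and> \<rho> = \<rho>'" using 1 by auto
    qed
    show "\<Phi> ` (relabellings (fst d) \<times> relabellings (snd d)) = ?X"
    proof (intro equalityI subsetI)
      fix \<sigma> assume "\<sigma> \<in> \<Phi> ` (relabellings (fst d) \<times> relabellings (snd d))"
      then obtain \<pi> \<rho> where \<pi>: "\<pi> \<in> relabellings (fst d)" and \<rho>: "\<rho> \<in> relabellings (snd d)"
        and \<sigma>: "\<sigma> = restrict (\<rho> \<circ> \<sigma>0 \<circ> \<pi>) ?S" by (auto simp: \<Phi>_def)
      have "bij_betw (\<rho> \<circ> \<sigma>0 \<circ> \<pi>) ?S ?T"
        by (rule bij_betw_trans[OF rel(1)[OF \<pi>] bij_betw_trans[OF b0 rel(1)[OF \<rho>], folded comp_assoc]])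
      then have bs: "bij_betw \<sigma> ?S ?T" by (simp add: \<sigma> bij_betw_restrict_eq)
      then have m: "\<sigma> \<in> matchings d" by (auto simp: matchings_def \<sigma> dest: bij_betwE)
      have "image_mset (f \<sigma>) (mset_set ?S) = image_mset (\<lambda>h. f \<sigma>0 (\<pi> h)) (mset_set ?S)"
        by (intro image_mset_cong) (simp add: f_def \<sigma> rel(2)[OF \<pi>] rel(2)[OF \<rho>])
      also have "\<dots> = image_mset (f \<sigma>0) (image_mset \<pi> (mset_set ?S))"
        by (simp add: multiset.map_comp o_def)
      also have "image_mset \<pi> (mset_set ?S) = mset_set ?S"
        using rel(1)[OF \<pi>] by (simp add: image_mset_mset_set bij_betw_def)
      finally have "edges (graph_of_matching d \<sigma>) = edges (graph_of_matching d \<sigma>0)" by (simp add: ed)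
      then have "graph_of_matching d \<sigma> = graph_of_matching d \<sigma>0" by (simp add: graph_of_matching_def)
      with m show "\<sigma> \<in> ?X" by simp
    next
      fix \<sigma> assume \<sigma>: "\<sigma> \<in> ?X"
      define \<pi> where "\<pi> h = (if h \<in> ?S then inv_into ?S (f \<sigma>0) (f \<sigma> h) else h)" for h
      have f\<pi>: "f \<sigma>0 (\<pi> h) = f \<sigma> h" if "h \<in> ?S" for h
        using that img[OF \<sigma>] by (auto simp: \<pi>_def intro!: f_inv_into_f)
      have "bij_betw (f \<sigma>) ?S (f \<sigma>0 ` ?S)" using inj[OF \<sigma>] img[OF \<sigma>] by (simp add: bij_betw_def)
      moreover have "bij_betw (inv_into ?S (f \<sigma>0)) (f \<sigma>0 ` ?S) ?S"
        using inj0 by (intro bij_betw_inv_into) (simp add: bij_betw_def)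
      ultimately have "bij_betw (inv_into ?S (f \<sigma>0) \<circ> f \<sigma>) ?S ?S" by (rule bij_betw_trans)
      then have b\<pi>: "bij_betw \<pi> ?S ?S"
        by (subst bij_betw_cong[where g = "inv_into ?S (f \<sigma>0) \<circ> f \<sigma>"]) (auto simp: \<pi>_def)
      have \<pi>: "\<pi> \<in> relabellings (fst d)"
      proof -
        have "\<pi> permutes ?S" by (rule bij_imp_permutes[OF b\<pi>]) (simp add: \<pi>_def)
        moreover have "fst (\<pi> h) = fst h" for h
          using f\<pi>[of h] by (cases "h \<in> ?S") (auto simp: f_def \<pi>_def)
        ultimately show ?thesis by (simp add: relabellings_def)
      qed
      \<comment> \<open>The only possible choice, as \<sigma> must be \<rho> \<circ> \<sigma>0 \<circ> \<pi>.\<close>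
      define \<rho> where "\<rho> t = (if t \<in> ?T then \<sigma> (inv_into ?S (\<sigma>0 \<circ> \<pi>) t) else t)" for t
      have b0\<pi>: "bij_betw (\<sigma>0 \<circ> \<pi>) ?S ?T" using b\<pi> b0 by (rule bij_betw_trans)
      have "bij_betw (\<sigma> \<circ> inv_into ?S (\<sigma>0 \<circ> \<pi>)) ?T ?T"
        using bij_betw_inv_into[OF b0\<pi>] b[OF \<sigma>] by (rule bij_betw_trans)
      then have b\<rho>: "bij_betw \<rho> ?T ?T"
        by (subst bij_betw_cong[where g = "\<sigma> \<circ> inv_into ?S (\<sigma>0 \<circ> \<pi>)"]) (auto simp: \<rho>_def)
      have \<rho>h: "\<rho> (\<sigma>0 (\<pi> h)) = \<sigma> h" if "h \<in> ?S" for h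
        using that bij_betw_inv_into_left[OF b0\<pi> that] bij_betwE[OF b0\<pi>] by (simp add: \<rho>_def)
      have \<rho>: "\<rho> \<in> relabellings (snd d)"
      proof -
        have "\<rho> permutes ?T" by (rule bij_imp_permutes[OF b\<rho>]) (simp add: \<rho>_def)
        moreover have "fst (\<rho> t) = fst t" for t
        proof (cases "t \<in> ?T")
          case True
          then have "t \<in> (\<sigma>0 \<circ> \<pi>) ` ?S" using b0\<pi> by (simp only: bij_betw_def)
          then obtain h where h: "h \<in> ?S" "t = \<sigma>0 (\<pi> h)" by auto
          then show ?thesis using \<rho>h f\<pi>[OF h(1)] by (simp add: f_def)
        qed (simp add: \<rho>_def)
        ultimately show ?thesis by (simp add: relabellings_def)
      qed
      have "\<sigma> = \<Phi> (\<pi>, \<rho>)"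
      proof (rule extensionalityI[of _ ?S])
        show "\<sigma> \<in> extensional ?S" using \<sigma> by (auto simp: matchings_def PiE_def)
      qed (auto simp: \<Phi>_def \<rho>h)
      with \<pi> \<rho> show "\<sigma> \<in> \<Phi> ` (relabellings (fst d) \<times> relabellings (snd d))" by auto
    qed
  qed
  then have "card ?X = card (relabellings (fst d) \<times> relabellings (snd d))"
    by (simp add: bij_betw_same_card)
  then show ?thesis by (simp add: card_cartesian_product)
qed

section \<open>The common conditional law\<close>

lemma cond_prob_eq_pmf_cond_pmf:
  assumes "set_pmf M \<inter> {H. Q H} \<noteq> {}"
  shows "\<P>(H in measure_pmf M. H = G \<bar> Q H) = pmf (cond_pmf M {H. Q H}) G"
proof -
  have "measure_pmf.prob M {H. H = G \<and> Q H} = (if Q G then pmf M G else 0)"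
  proof -
    have "{H. H = G \<and> Q H} = (if Q G then {G} else {})" by auto
    then show ?thesis by (simp add: measure_pmf_single)
  qed
  then show ?thesis by (simp add: cond_prob_def pmf_cond[OF assms])
qed

lemma prob_cond_pmf:
  assumes "set_pmf M \<inter> S \<noteq> {}"
  shows "measure_pmf.prob (cond_pmf M S) A = measure_pmf.prob M (S \<inter> A) / measure_pmf.prob M S"
  using measure_measure_pmf_not_zero[OF assms]
  by (simp add: cond_pmf.rep_eq[OF assms] measure_pmf.emeasure_eq_measure)

text \<open>A law that is constant on \<open>C\<close> and vanishes on the rest of \<open>S\<close> becomes uniform on \<open>C\<close> when conditioned
on \<open>S\<close>; the constant need not be known.\<close>

lemma cond_pmf_eq_pmf_of_set:
  assumes C: "finite C" "C \<noteq> {}" "C \<subseteq> S" and c: "c > 0" "\<And>H. H \<in> C \<Longrightarrow> pmf M H = c"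
    and out: "\<And>H. H \<in> S \<Longrightarrow> H \<notin> C \<Longrightarrow> pmf M H = 0"
  shows "set_pmf M \<inter> S \<noteq> {}" "cond_pmf M S = pmf_of_set C"
proof -
  show ne: "set_pmf M \<inter> S \<noteq> {}"
    using C c by (force simp: set_pmf_iff)
  have "measure_pmf.prob M S = measure_pmf.prob M C"
    by (rule measure_prob_cong_0) (use C out in auto)
  also have "\<dots> = card C * c"
    using C c by (simp add: measure_measure_pmf_finite)
  finally have S: "measure_pmf.prob M S = card C * c" .
  have "card C > 0" using C by (simp add: card_gt_0_iff)
  then show "cond_pmf M S = pmf_of_set C"
    using C c out by (intro pmf_eqI) (auto simp: pmf_cond[OF ne] S indicator_def)
qed

definition group_graphs_with :: "nat \<Rightarrow> degree_seq \<Rightarrow> bmgraph set" where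
  "group_graphs_with n d = {G \<in> group_graphs n. degree_sequence G = d}"

lemma finite_group_graphs: "finite (group_graphs n)"
proof -
  have "{as. distinct as \<and> set as \<subseteq> groups n} = {as. set as \<subseteq> groups n \<and> distinct as}" by auto
  then show ?thesis unfolding group_graphs_def using finite_subset_distinct[OF finite_groups, of n] by simp
qed

lemma group_graphsD:
  assumes "G \<in> group_graphs n"
  shows "simple_bmgraph G" "distinct_groups G" "nleft G = n" "length (fst (degree_sequence G)) = n"
    and "set_mset (edges G) \<subseteq> {1..nleft G} \<times> {1..nright G}"
    and "\<And>k. k \<in> set (snd (degree_sequence G)) \<Longrightarrow> 2 \<le> k"
proof -
  obtain as where as: "distinct as" "set as \<subseteq> groups n" and G: "G = graph_of_groups n as"
    using assms by (auto simp: group_graphs_def)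
  show "simple_bmgraph G" "distinct_groups G" "nleft G = n"
    unfolding G by (simp_all add: simple_graph_of_groups distinct_groups_graph_of_groups as)
  show "length (fst (degree_sequence G)) = n"
    unfolding G by (simp add: degree_sequence_def)
  show "2 \<le> k" if "k \<in> set (snd (degree_sequence G))" for k
    using that as(2) unfolding G degree_sequence_graph_of_groups[OF as(2)] by (auto simp: groups_def)
  show "set_mset (edges G) \<subseteq> {1..nleft G} \<times> {1..nright G}"
    unfolding G using finite_incidences[OF as(2)] incidences_subset[OF as(2)] by simp
qed

lemma matchings_of_group_graph:
  assumes "G \<in> group_graphs_with n d"
  obtains \<sigma> where "\<sigma> \<in> matchings d" "graph_of_matching d \<sigma> = G"
proof -
  have G: "G \<in> group_graphs n" "degree_sequence G = d" using assms by (auto simp: group_graphs_with_def)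
  show ?thesis
    by (rule ex_matching_of_graph[OF group_graphsD(1)[OF G(1)] group_graphsD(5)[OF G(1)] G(2) that])
qed

lemma finite_matchings: "finite (matchings d)"
  unfolding matchings_eq_bijections by (rule finite_bijections) auto

lemma pmf_BCM:
  assumes ne: "matchings d \<noteq> {}"
  shows "pmf (BCM d) G = card {\<sigma> \<in> matchings d. graph_of_matching d \<sigma> = G} / card (matchings d)"
proof -
  have "matchings d \<inter> graph_of_matching d -` {G} = {\<sigma> \<in> matchings d. graph_of_matching d \<sigma> = G}" by auto
  then show ?thesis
    by (simp add: BCM_def pmf_map measure_pmf_of_set[OF ne finite_matchings])
qed

abbreviation good_graphs :: "bmgraph set" where
  "good_graphs \<equiv> {H. simple_bmgraph H \<and> distinct_groups H}"

lemma cond_BCM: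
  assumes ne: "group_graphs_with n d \<noteq> {}"
  shows "set_pmf (BCM d) \<inter> good_graphs \<noteq> {}"
    and "cond_pmf (BCM d) good_graphs = pmf_of_set (group_graphs_with n d)"
proof -
  obtain G0 where G0: "G0 \<in> group_graphs_with n d" using ne by auto
  then have d: "length (fst d) = n" "\<And>k. k \<in> set (snd d) \<Longrightarrow> 2 \<le> k"
    using group_graphsD[of G0 n] by (auto simp: group_graphs_with_def)
  define c where "c = real (card (relabellings (fst d)) * card (relabellings (snd d))) / card (matchings d)"
  obtain \<sigma>0 where \<sigma>0: "\<sigma>0 \<in> matchings d" using G0 by (rule matchings_of_group_graph)
  then have mne: "matchings d \<noteq> {}" by auto
  have c: "pmf (BCM d) G = c" if G: "G \<in> group_graphs_with n d" for G
  proof -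
    obtain \<sigma> where \<sigma>: "\<sigma> \<in> matchings d" "graph_of_matching d \<sigma> = G" using G by (rule matchings_of_group_graph)
    have "simple_bmgraph G" using G group_graphsD(1) by (auto simp: group_graphs_with_def)
    then have "card {\<sigma> \<in> matchings d. graph_of_matching d \<sigma> = G} = card (relabellings (fst d)) * card (relabellings (snd d))"
      using card_matchings_of_simple_graph[OF \<sigma>(1)] \<sigma>(2) by simp
    then show ?thesis by (simp add: pmf_BCM[OF mne] c_def)
  qed
  have cpos: "c > 0"
  proof -
    obtain \<sigma> where \<sigma>: "\<sigma> \<in> matchings d" "graph_of_matching d \<sigma> = G0" using G0 by (rule matchings_of_group_graph)
    have "0 < card {\<sigma> \<in> matchings d. graph_of_matching d \<sigma> = G0}"
      using \<sigma> finite_matchings[of d] by (subst card_gt_0_iff) auto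
    moreover have "0 < card (matchings d)" using mne finite_matchings[of d] by (simp add: card_gt_0_iff)
    ultimately show ?thesis unfolding c[OF G0, symmetric] pmf_BCM[OF mne] by simp
  qed
  have sub: "group_graphs_with n d \<subseteq> good_graphs"
    using group_graphsD(1,2) by (auto simp: group_graphs_with_def)
  have out: "pmf (BCM d) H = 0" if "H \<in> good_graphs" "H \<notin> group_graphs_with n d" for H
  proof (rule ccontr)
    assume "pmf (BCM d) H \<noteq> 0"
    then have "H \<in> set_pmf (BCM d)" by (simp add: set_pmf_iff)
    then obtain \<sigma> where \<sigma>: "\<sigma> \<in> matchings d" "H = graph_of_matching d \<sigma>"
      unfolding BCM_def by (auto simp: set_pmf_of_set[OF mne finite_matchings])
    have ds: "degree_sequence H = d" using degree_sequence_graph_of_matching[OF \<sigma>(1)] \<sigma>(2) by simp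
    have nl: "nleft H = length (fst d)" "nright H = length (snd d)" by (simp_all add: \<sigma>(2) graph_of_matching_def)
    have "H \<in> group_graphs (nleft H)"
    proof (rule in_group_graphsI)
      show "set_mset (edges H) \<subseteq> {1..nleft H} \<times> {1..nright H}"
        using edges_in_range_graph_of_matching[OF \<sigma>(1)] unfolding nl by (simp add: \<sigma>(2))
    qed (use that(1) d(2) ds in auto)
    then have "H \<in> group_graphs_with n d" using ds nl(1) d(1) by (simp add: group_graphs_with_def)
    with that(2) show False by simp
  qed
  have fin: "finite (group_graphs_with n d)"
    using finite_group_graphs[of n] by (simp add: group_graphs_with_def)
  show "set_pmf (BCM d) \<inter> good_graphs \<noteq> {}"
    by (rule cond_pmf_eq_pmf_of_set(1)[OF fin ne sub cpos c out])
  show "cond_pmf (BCM d) good_graphs = pmf_of_set (group_graphs_with n d)"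
    by (rule cond_pmf_eq_pmf_of_set(2)[OF fin ne sub cpos c out])
qed

lemma cond_BGRG:
  assumes w: "\<And>i. i \<in> {1..n} \<Longrightarrow> w i \<ge> 0" and l: "total_weight n w > 0"
    and d: "d \<in> set_pmf (degree_law p n w)"
  shows "group_graphs_with n d \<noteq> {}" and "set_pmf (BGRG p n w) \<inter> {H. degree_sequence H = d} \<noteq> {}"
    and "cond_pmf (BGRG p n w) {H. degree_sequence H = d} = pmf_of_set (group_graphs_with n d)"
proof -
  obtain G where G: "G \<in> set_pmf (BGRG p n w)" "degree_sequence G = d"
    using d by (auto simp: degree_law_def)
  have Gg: "G \<in> group_graphs_with n d" using G set_BGRG by (auto simp: group_graphs_with_def)
  show ne: "group_graphs_with n d \<noteq> {}" using Gg by auto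
  have c: "pmf (BGRG p n w) H = degree_weight p n w d" if "H \<in> group_graphs_with n d" for H
    using that pmf_BGRG[OF w l, of H] by (auto simp: group_graphs_with_def)
  have "pmf (BGRG p n w) G > 0" using G(1) by (simp add: pmf_positive)
  then have cpos: "degree_weight p n w d > 0" using c[OF Gg] by simp
  have out: "pmf (BGRG p n w) H = 0" if "H \<in> {H. degree_sequence H = d}" "H \<notin> group_graphs_with n d" for H
    using that set_BGRG[of p n w] by (auto simp: group_graphs_with_def set_pmf_iff)
  have fin: "finite (group_graphs_with n d)"
    using finite_group_graphs[of n] by (simp add: group_graphs_with_def)
  have sub: "group_graphs_with n d \<subseteq> {H. degree_sequence H = d}" by (auto simp: group_graphs_with_def)
  show "set_pmf (BGRG p n w) \<inter> {H. degree_sequence H = d} \<noteq> {}"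
    by (rule cond_pmf_eq_pmf_of_set(1)[OF fin ne sub cpos c out])
  show "cond_pmf (BGRG p n w) {H. degree_sequence H = d} = pmf_of_set (group_graphs_with n d)"
    by (rule cond_pmf_eq_pmf_of_set(2)[OF fin ne sub cpos c out])
qed

text \<open>The first assertion in the form in which the second one uses it: sample the degree sequence, then a
configuration model conditioned on being good.\<close>

lemma BGRG_eq_bind_cond_BCM:
  assumes w: "\<And>i. i \<in> {1..n} \<Longrightarrow> w i \<ge> 0" and l: "total_weight n w > 0"
  shows "BGRG p n w = bind_pmf (degree_law p n w) (\<lambda>d. cond_pmf (BCM d) good_graphs)"
proof -
  have "BGRG p n w = bind_pmf (degree_law p n w) (\<lambda>d. cond_pmf (BGRG p n w) {H. degree_sequence H = d})"
  proof (rule bind_cond_pmf_cancel[symmetric])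
    fix d assume "d \<in> set_pmf (degree_law p n w)"
    then show "set_pmf (BGRG p n w) \<inter> {H. degree_sequence H = d} \<noteq> {}" by (intro cond_BGRG(2) w l)
  next
    fix H assume "H \<in> set_pmf (BGRG p n w)"
    then show "set_pmf (degree_law p n w) \<inter> {d. degree_sequence H = d} \<noteq> {}" by (auto simp: degree_law_def)
  next
    fix d H assume "degree_sequence H = d"
    then show "measure_pmf.prob (BGRG p n w) {H. degree_sequence H = d} =
        measure_pmf.prob (degree_law p n w) {d. degree_sequence H = d}"
      by (simp add: degree_law_def vimage_def eq_commute)
  qed
  also have "\<dots> = bind_pmf (degree_law p n w) (\<lambda>d. cond_pmf (BCM d) good_graphs)"
  proof (intro bind_pmf_cong refl)
    fix d assume d: "d \<in> set_pmf (degree_law p n w)"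
    have "group_graphs_with n d \<noteq> {}" by (intro cond_BGRG(1)[where w = w and p = p] w l d)
    moreover have "cond_pmf (BGRG p n w) {H. degree_sequence H = d} = pmf_of_set (group_graphs_with n d)"
      by (intro cond_BGRG(3) w l d)
    ultimately show "cond_pmf (BGRG p n w) {H. degree_sequence H = d} = cond_pmf (BCM d) good_graphs"
      by (simp add: cond_BCM(2))
  qed
  finally show ?thesis .
qed

section \<open>A lower bound for the probability of a simple graph with distinct groups\<close>

text \<open>A single degree is at most the square root of the sum of the squared degrees, hence
\<open>D = (K N)\<^sup>1\<^sup>/\<^sup>2\<close> is admissible in \<open>avoiding_doubles_squares\<close>. Squaring turns
the condition \<open>1024 K\<^sup>3 D \<le> N\<close> of that lemma into the one that relates \<open>K\<close> and \<open>N\<close> here.\<close>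

lemma prob_BCM_good_ge:
  fixes K :: real and N :: nat
  assumes N: "sum_list (fst d) = N" "sum_list (snd d) = N" "8 \<le> N" "1024 ^ 2 * K ^ 7 \<le> N" and K: "1 \<le> K"
    and l2: "(\<Sum>i<length (fst d). real (fst d ! i) ^ 2) \<le> K * N"
    and r2: "(\<Sum>a<length (snd d). real (snd d ! a) ^ 2) \<le> K * N"
    and d2: "\<And>k. k \<in> set (snd d) \<Longrightarrow> 2 \<le> k"
  shows "exp (- 128 * K ^ 4) \<le> measure_pmf.prob (BCM d) good_graphs"
proof -
  let ?S = "half_edges (fst d)" and ?T = "half_edges (snd d)"
  let ?B = "doubles (twins (fst d)) (twins (snd d)) \<union> squares (twins (fst d)) (twins (snd d))"
  define D where "D = sqrt (K * N)"
  have KN: "0 \<le> K * N" using K by simp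
  have sq: "real (\<Sum>i<length ds. (ds ! i) ^ 2) = (\<Sum>i<length ds. real (ds ! i) ^ 2)" for ds :: "nat list"
    by simp
  have Dle: "real (card (twins ds `` {h})) \<le> D" if "(\<Sum>i<length ds. real (ds ! i) ^ 2) \<le> K * N" for ds h
  proof -
    have "real (card (twins ds `` {h})) ^ 2 \<le> K * N"
      using of_nat_mono[OF card_twins_Image_le[of ds h], where 'a = real] that by simp
    then show ?thesis unfolding D_def by (rule real_le_rsqrt)
  qed
  have cle: "real (card (twins ds)) \<le> K * N" if "(\<Sum>i<length ds. real (ds ! i) ^ 2) \<le> K * N" for ds
    using of_nat_mono[OF card_twins_le[of ds], where 'a = real] that by simp
  have D: "1024 * K ^ 3 * D \<le> N"
  proof (rule power2_le_imp_le)
    have "(1024 * K ^ 3 * D)\<^sup>2 = (1024 ^ 2 * K ^ 7) * N"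
      using KN by (simp add: power_mult_distrib D_def flip: power_mult) (simp add: algebra_simps power_numeral_reduce)
    also have "\<dots> \<le> real N * real N" using N(4) by (rule mult_right_mono) simp
    finally show "(1024 * K ^ 3 * D)\<^sup>2 \<le> (real N)\<^sup>2" by (simp add: power2_eq_square)
  qed simp
  have "exp (- 128 * K ^ 4) \<le> measure_pmf.prob (pmf_of_set (bijections ?S ?T)) (avoiding extending ?B)"
    using N K D cle[OF l2] cle[OF r2] Dle[OF l2] Dle[OF r2]
    by (intro avoiding_doubles_squares[where N = N and D = D])
       (auto simp: card_half_edges sym_twins irrefl_twins twins_subset)
  also have "\<dots> \<le> measure_pmf.prob (pmf_of_set (bijections ?S ?T)) (graph_of_matching d -` good_graphs)"
  proof -
    have card: "card ?S = card ?T" using N by (simp add: card_half_edges)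
    then obtain h where "bij_betw h ?S ?T" by (metis finite_same_card_bij finite_half_edges)
    then have "restrict h ?S \<in> bijections ?S ?T"
      by (auto simp: bijections_def bij_betw_restrict_eq dest: bij_betwE)
    then have ne: "bijections ?S ?T \<noteq> {}" by auto
    have fin: "finite (bijections ?S ?T)" by (rule finite_bijections) auto
    have "bijections ?S ?T \<inter> avoiding extending ?B \<subseteq> bijections ?S ?T \<inter> graph_of_matching d -` good_graphs"
      using graph_of_matching_good[of _ d] d2 by (auto simp: matchings_eq_bijections)
    then have "card (bijections ?S ?T \<inter> avoiding extending ?B) \<le> card (bijections ?S ?T \<inter> graph_of_matching d -` good_graphs)"
      using fin by (intro card_mono) auto
    then show ?thesis by (simp add: measure_pmf_of_set[OF ne fin] divide_right_mono)
  qed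
  also have "\<dots> = measure_pmf.prob (BCM d) good_graphs"
    by (simp add: BCM_def matchings_eq_bijections)
  finally show ?thesis .
qed

lemma unif_moment_times_length:
  "unif_moment r ds * real (length ds) = (\<Sum>i<length ds. real (ds ! i) ^ r)"
  by (cases "length ds = 0") (auto simp: unif_moment_def)

lemma degree_seq_of_group_graph:
  assumes "group_graphs_with n d \<noteq> {}"
  shows "length (fst d) = n" and "sum_list (fst d) = sum_list (snd d)"
    and "\<And>k. k \<in> set (snd d) \<Longrightarrow> 2 \<le> k"
proof -
  obtain G where G: "G \<in> group_graphs_with n d" using assms by auto
  then show "length (fst d) = n" "\<And>k. k \<in> set (snd d) \<Longrightarrow> 2 \<le> k"
    using group_graphsD[of G n] by (auto simp: group_graphs_with_def)
  obtain \<sigma> where "\<sigma> \<in> matchings d" using G by (rule matchings_of_group_graph)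
  then have "bij_betw \<sigma> (half_edges (fst d)) (half_edges (snd d))" by (simp add: matchings_def)
  from bij_betw_same_card[OF this] show "sum_list (fst d) = sum_list (snd d)"
    by (simp add: card_half_edges)
qed

text \<open>The empirical moments enter through the number \<open>N\<close> of edges: the mean left-degree bounds \<open>N\<close> from
below by a multiple of \<open>n\<close>, and as no group is empty, \<open>N\<close> is at least the number of groups, so that
both sums of squared degrees are \<open>O(N)\<close>.\<close>

lemma prob_BCM_good_ge_of_moments:
  fixes \<mu> A B K :: real
  assumes ne: "group_graphs_with n d \<noteq> {}"
    and \<mu>: "\<mu> > 0" "\<mu> \<le> unif_moment 1 (fst d)" and A: "unif_moment 2 (fst d) \<le> A"
    and B: "unif_moment 2 (snd d) \<le> B"
    and K: "1 \<le> K" "A / \<mu> \<le> K" "B \<le> K" and n: "8 \<le> \<mu> * n" "1024 ^ 2 * K ^ 7 \<le> \<mu> * n"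
  shows "exp (- 128 * K ^ 4) \<le> measure_pmf.prob (BCM d) good_graphs"
proof -
  note len = degree_seq_of_group_graph(1)[OF ne] and sum_eq = degree_seq_of_group_graph(2)[OF ne]
    and d2 = degree_seq_of_group_graph(3)[OF ne]
  define N where "N = sum_list (fst d)"
  have "\<mu> * n \<le> unif_moment 1 (fst d) * n" using \<mu> by (intro mult_right_mono) auto
  also have "\<dots> = N" using unif_moment_times_length[of 1 "fst d"]
    by (simp add: len N_def sum_list_sum_nth lessThan_atLeast0)
  finally have \<mu>N: "\<mu> * n \<le> N" .
  have N8: "8 \<le> N" using n(1) \<mu>N by linarith
  have "(\<Sum>i<length (fst d). real (fst d ! i) ^ 2) \<le> A * n"
    using mult_right_mono[OF A, of "real n"] unif_moment_times_length[of 2 "fst d"] len by simp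
  also have "\<dots> = (A / \<mu>) * (\<mu> * n)" using \<mu> by simp
  also have "\<dots> \<le> K * N" using K \<mu> \<mu>N by (intro mult_mono) auto
  finally have l2: "(\<Sum>i<length (fst d). real (fst d ! i) ^ 2) \<le> K * N" .
  have "length (snd d) * 1 \<le> sum_list (snd d)"
  proof -
    have "sum_list (map (\<lambda>_. 1) (snd d)) \<le> sum_list (map (\<lambda>k. k) (snd d))"
      using d2 by (intro sum_list_mono) fastforce
    then show ?thesis by (simp add: sum_list_triv)
  qed
  then have m: "real (length (snd d)) \<le> N" using sum_eq by (simp add: N_def)
  have "(\<Sum>a<length (snd d). real (snd d ! a) ^ 2) \<le> K * real (length (snd d))"
    using B K mult_right_mono[of "unif_moment 2 (snd d)" K "real (length (snd d))"]
      unif_moment_times_length[of 2 "snd d"]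
    by simp
  also have "\<dots> \<le> K * N" using m K by (intro mult_left_mono) auto
  finally have r2: "(\<Sum>a<length (snd d). real (snd d ! a) ^ 2) \<le> K * N" .
  show ?thesis
    by (rule prob_BCM_good_ge[where N = N])
      (use N8 n(2) \<mu>N K(1) l2 r2 d2 sum_eq in \<open>auto simp: N_def\<close>)
qed

section \<open>Transfer of high-probability properties\<close>

lemma prob_bind_pmf_le:
  assumes "\<And>d. d \<in> set_pmf M \<Longrightarrow> d \<notin> B \<Longrightarrow> measure_pmf.prob (N d) A \<le> e" and e: "0 \<le> e"
  shows "measure_pmf.prob (bind_pmf M N) A \<le> measure_pmf.prob M B + e"
proof -
  have "emeasure (bind_pmf M N) A = (\<integral>\<^sup>+d. emeasure (N d) A \<partial>measure_pmf M)"
    by (rule emeasure_bind_pmf)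
  also have "\<dots> \<le> (\<integral>\<^sup>+d. indicator B d + ennreal e \<partial>measure_pmf M)"
  proof (intro nn_integral_mono_AE AE_pmfI)
    fix d assume d: "d \<in> set_pmf M"
    show "emeasure (measure_pmf (N d)) A \<le> indicator B d + ennreal e"
    proof (cases "d \<in> B")
      case True
      then show ?thesis
        using measure_pmf.emeasure_le_1[of "N d" A] by (simp add: add_increasing2)
    next
      case False
      then show ?thesis using assms(1)[OF d] by (simp add: measure_pmf.emeasure_eq_measure ennreal_leI)
    qed
  qed
  also have "\<dots> = ennreal (measure_pmf.prob M B + e)"
    using e by (simp add: nn_integral_add measure_pmf.emeasure_eq_measure ennreal_plus)
  finally show ?thesis
    using e by (simp add: measure_pmf.emeasure_eq_measure del: ennreal_plus)
qed

theorem theorem2p4: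
  fixes p :: "nat pmf" and w :: "nat \<Rightarrow> nat \<Rightarrow> real"
  assumes "set_pmf p \<subseteq> {2..}"
    and "integrable p real"
    and "integrable p (\<lambda>k. real k ^ 2)"
    and "\<And>n i. n \<ge> 1 \<Longrightarrow> i \<in> {1..n} \<Longrightarrow> w n i \<ge> 0"
    and "\<And>n. n \<ge> 1 \<Longrightarrow> total_weight n (w n) > 0"
  shows "(\<forall>n\<ge>1. \<forall>d \<in> set_pmf (degree_law p n (w n)). \<forall>G.
            \<P>(H in BGRG p n (w n). H = G \<bar> degree_sequence H = d) =
            \<P>(H in BCM d. H = G \<bar> simple_bmgraph H \<and> distinct_groups H)) \<and>
         (\<forall>(\<E> :: nat \<Rightarrow> bmgraph set) (Dl :: nat pmf) (Dr :: nat pmf).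
            regular_i (\<lambda>n. degree_law p n (w n)) Dl Dr \<longrightarrow>
            regular_ii (\<lambda>n. degree_law p n (w n)) Dl Dr \<longrightarrow>
            measure_pmf.expectation Dl real > 0 \<longrightarrow>
            tendsto_in_prob (\<lambda>n. degree_law p n (w n))
              (\<lambda>n d. measure_pmf.prob (BCM d) (\<E> n)) 1 \<longrightarrow>
            (\<lambda>n. measure_pmf.prob (BGRG p n (w n)) (\<E> n)) \<longlonglongrightarrow> 1)"
proof (intro conjI allI impI ballI)
  fix n d G assume n: "1 \<le> n" and d: "d \<in> set_pmf (degree_law p n (w n))"
  have w: "\<And>i. i \<in> {1..n} \<Longrightarrow> w n i \<ge> 0" and l: "total_weight n (w n) > 0"
    using assms(4,5) n by auto
  have ne: "group_graphs_with n d \<noteq> {}"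
    and ne1: "set_pmf (BGRG p n (w n)) \<inter> {H. degree_sequence H = d} \<noteq> {}"
    and c1: "cond_pmf (BGRG p n (w n)) {H. degree_sequence H = d} = pmf_of_set (group_graphs_with n d)"
    using cond_BGRG[of n "w n" d p] w l d by blast+
  show "\<P>(H in BGRG p n (w n). H = G \<bar> degree_sequence H = d) =
      \<P>(H in BCM d. H = G \<bar> simple_bmgraph H \<and> distinct_groups H)"
    by (simp add: cond_prob_eq_pmf_cond_pmf[OF ne1] cond_prob_eq_pmf_cond_pmf[OF cond_BCM(1)[OF ne]]
        c1 cond_BCM(2)[OF ne])
next
  fix \<E> :: "nat \<Rightarrow> bmgraph set" and Dl Dr :: "nat pmf"
  let ?M = "\<lambda>n. degree_law p n (w n)"
  define \<mu> where "\<mu> = measure_pmf.expectation Dl real"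
  define sl where "sl = measure_pmf.expectation Dl (\<lambda>k. real k ^ 2)"
  define sr where "sr = measure_pmf.expectation Dr (\<lambda>k. real k ^ 2)"
  assume i: "regular_i ?M Dl Dr" and ii: "regular_ii ?M Dl Dr"
    and pos: "measure_pmf.expectation Dl real > 0"
    and E: "tendsto_in_prob ?M (\<lambda>n d. measure_pmf.prob (BCM d) (\<E> n)) 1"
  have \<mu>: "\<mu> > 0" using pos by (simp add: \<mu>_def)
  \<comment> \<open>On the typical event the mean left-degree is at least \<mu> / 2 and the second moments exceed their
    limits by at most 1.\<close>
  define K where "K = max 1 (max ((sl + 1) / (\<mu> / 2)) (sr + 1))"
  define \<delta> where "\<delta> = exp (- 128 * K ^ 4)"
  have \<delta>: "\<delta> > 0" by (simp add: \<delta>_def)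
  have limE: "(\<lambda>n. measure_pmf.prob (?M n) {d. \<bar>measure_pmf.prob (BCM d) (\<E> n) - 1\<bar> > \<eta>}) \<longlonglongrightarrow> 0"
    if "\<eta> > 0" for \<eta>
    using E that by (simp add: tendsto_in_prob_def)
  have lim1: "(\<lambda>n. measure_pmf.prob (?M n) {d. \<bar>unif_moment 1 (fst d) - \<mu>\<bar> > \<mu> / 2}) \<longlonglongrightarrow> 0"
  proof -
    have "tendsto_in_prob ?M (\<lambda>n d. unif_moment 1 (fst d)) \<mu>"
      using i by (simp add: regular_i_def \<mu>_def)
    then show ?thesis unfolding tendsto_in_prob_def using half_gt_zero[OF \<mu>] by blast
  qed
  have lim2: "(\<lambda>n. measure_pmf.prob (?M n) {d. \<bar>unif_moment 2 (fst d) - sl\<bar> > 1}) \<longlonglongrightarrow> 0"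
    using ii by (simp add: regular_ii_def tendsto_in_prob_def sl_def)
  have lim3: "(\<lambda>n. measure_pmf.prob (?M n) {d. \<bar>unif_moment 2 (snd d) - sr\<bar> > 1}) \<longlonglongrightarrow> 0"
    using ii by (simp add: regular_ii_def tendsto_in_prob_def sr_def)
  have lin: "filterlim (\<lambda>n. \<mu> / 2 * real n) at_top sequentially"
    using \<mu> by (intro filterlim_tendsto_pos_mult_at_top[OF tendsto_const] filterlim_real_sequentially) auto
  have "(\<lambda>n. measure_pmf.prob (BGRG p n (w n)) (- \<E> n)) \<longlonglongrightarrow> 0"
  proof (rule order_tendstoI)
    fix e :: real assume "0 < e"
    \<comment> \<open>Conditioning on a good graph costs a factor 1 / \<delta>, so this choice leaves e / 2. The other half
      of e is shared by the four bad events that make up B.\<close>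
    define \<eta> where "\<eta> = e / 2 * \<delta>"
    have \<eta>: "\<eta> > 0" using \<open>0 < e\<close> \<delta> by (simp add: \<eta>_def)
    define B where "B n = {d. \<bar>measure_pmf.prob (BCM d) (\<E> n) - 1\<bar> > \<eta>} \<union>
      ({d. \<bar>unif_moment 1 (fst d) - \<mu>\<bar> > \<mu> / 2} \<union>
       ({d. \<bar>unif_moment 2 (fst d) - sl\<bar> > 1} \<union> {d. \<bar>unif_moment 2 (snd d) - sr\<bar> > 1}))" for n
    have e8: "0 < e / 8" using \<open>0 < e\<close> by simp
    have "eventually (\<lambda>n. 8 \<le> \<mu> / 2 * real n \<and> 1024 ^ 2 * K ^ 7 \<le> \<mu> / 2 * real n) sequentially"
      by (intro eventually_conj lin[unfolded filterlim_at_top, rule_format])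
    moreover note order_tendstoD(2)[OF limE[OF \<eta>] e8] order_tendstoD(2)[OF lim1 e8]
      order_tendstoD(2)[OF lim2 e8] order_tendstoD(2)[OF lim3 e8] eventually_ge_at_top[of 1]
    ultimately show "eventually (\<lambda>n. measure_pmf.prob (BGRG p n (w n)) (- \<E> n) < e) sequentially"
    proof eventually_elim
      case (elim n)
      have w: "\<And>i. i \<in> {1..n} \<Longrightarrow> w n i \<ge> 0" and l: "total_weight n (w n) > 0"
        using assms(4,5) elim by auto
      have "measure_pmf.prob (bind_pmf (?M n) (\<lambda>d. cond_pmf (BCM d) good_graphs)) (- \<E> n)
        \<le> measure_pmf.prob (?M n) (B n) + e / 2"
      proof (rule prob_bind_pmf_le)
        fix d assume d: "d \<in> set_pmf (?M n)" and "d \<notin> B n"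
        then have g: "\<bar>measure_pmf.prob (BCM d) (\<E> n) - 1\<bar> \<le> \<eta>" "\<bar>unif_moment 1 (fst d) - \<mu>\<bar> \<le> \<mu> / 2"
          "\<bar>unif_moment 2 (fst d) - sl\<bar> \<le> 1" "\<bar>unif_moment 2 (snd d) - sr\<bar> \<le> 1"
          by (auto simp: B_def not_less)
        have gne: "group_graphs_with n d \<noteq> {}" by (intro cond_BGRG(1)[where w = "w n" and p = p] w l d)
        then have ne: "set_pmf (BCM d) \<inter> good_graphs \<noteq> {}" by (rule cond_BCM(1))
        have low: "\<delta> \<le> measure_pmf.prob (BCM d) good_graphs"
          unfolding \<delta>_def
        proof (rule prob_BCM_good_ge_of_moments[OF gne])
          show "\<mu> / 2 \<le> unif_moment 1 (fst d)" using g(2) by linarith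
          show "unif_moment 2 (fst d) \<le> sl + 1" using g(3) by linarith
          show "unif_moment 2 (snd d) \<le> sr + 1" using g(4) by linarith
        qed (use \<mu> elim(1) in \<open>auto simp: K_def\<close>)
        have "measure_pmf.prob (cond_pmf (BCM d) good_graphs) (- \<E> n)
            = measure_pmf.prob (BCM d) (good_graphs \<inter> - \<E> n) / measure_pmf.prob (BCM d) good_graphs"
          by (rule prob_cond_pmf[OF ne])
        also have "\<dots> \<le> \<eta> / \<delta>"
        proof (rule frac_le)
          have "measure_pmf.prob (BCM d) (good_graphs \<inter> - \<E> n) \<le> measure_pmf.prob (BCM d) (- \<E> n)"
            by (intro measure_pmf.finite_measure_mono) auto
          also have "\<dots> = 1 - measure_pmf.prob (BCM d) (\<E> n)"
            using measure_pmf.prob_compl[of "\<E> n" "BCM d"] by (simp add: Compl_eq_Diff_UNIV)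
          also have "\<dots> \<le> \<eta>" using g(1) by linarith
          finally show "measure_pmf.prob (BCM d) (good_graphs \<inter> - \<E> n) \<le> \<eta>" .
        qed (use \<eta> \<delta> low in auto)
        also have "\<dots> = e / 2" using \<delta> by (simp add: \<eta>_def)
        finally show "measure_pmf.prob (cond_pmf (BCM d) good_graphs) (- \<E> n) \<le> e / 2" .
      qed (use \<open>0 < e\<close> in simp)
      also have "measure_pmf.prob (?M n) (B n) \<le>
        measure_pmf.prob (?M n) {d. \<bar>measure_pmf.prob (BCM d) (\<E> n) - 1\<bar> > \<eta>} +
        (measure_pmf.prob (?M n) {d. \<bar>unif_moment 1 (fst d) - \<mu>\<bar> > \<mu> / 2} +
        (measure_pmf.prob (?M n) {d. \<bar>unif_moment 2 (fst d) - sl\<bar> > 1} +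
         measure_pmf.prob (?M n) {d. \<bar>unif_moment 2 (snd d) - sr\<bar> > 1}))"
        unfolding B_def
        by (intro order_trans[OF measure_Un_le] add_mono order_refl) auto
      finally show ?case
        using elim \<open>0 < e\<close> BGRG_eq_bind_cond_BCM[of n "w n" p] w l by simp
    qed
  next
    fix a :: real assume "a < 0"
    then show "eventually (\<lambda>n. a < measure_pmf.prob (BGRG p n (w n)) (- \<E> n)) sequentially"
      by (intro always_eventually allI) (rule less_le_trans[OF _ measure_nonneg])
  qed
  then have "(\<lambda>n. 1 - measure_pmf.prob (BGRG p n (w n)) (- \<E> n)) \<longlonglongrightarrow> 1 - 0"
    by (intro tendsto_intros)
  moreover have "1 - measure_pmf.prob (BGRG p n (w n)) (- \<E> n) = measure_pmf.prob (BGRG p n (w n)) (\<E> n)" for n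
    using measure_pmf.prob_compl[of "\<E> n" "BGRG p n (w n)"] by (simp add: Compl_eq_Diff_UNIV)
  ultimately show "(\<lambda>n. measure_pmf.prob (BGRG p n (w n)) (\<E> n)) \<longlonglongrightarrow> 1" by simp
qed

end
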